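(* Apply the project-and-filter scheme described in the context: at every experimental iteration where the projection problem is feasible, set $\mathbf u_{k+1}:=\mathbf u_k+K_k(\bar{\mathbf u}_{k+1}^*-\mathbf u_k)$ with $K_k$ the maximum value on $[0,1]$ satisfying the three gain conditions (i)–(iii) of the context, and set $\mathbf u_{k+1}:=\mathbf u_k$ if the projection problem is not feasible, with $\mathbf u_\infty$ denoting the (first) point where this infeasibility occurs. Then $$\lim_{\boldsymbol\epsilon_p,\,\boldsymbol\epsilon,\,\boldsymbol\delta_{g_p},\,\boldsymbol\delta_g,\,\delta_\phi\,\downarrow\,\mathbf 0}\mathcal E(\mathbf u_\infty)=0,$$ where $\mathcal E$ is the Fritz John error metric defined in the context.
   Context: Problem: minimize $\phi_p(\mathbf u)$ over $\mathbf u\in\mathbb R^{n_u}$ subject to $g_{p,j}(\mathbf u)\le 0$ ($j=1,\dots,n_{g_p}$), $g_j(\mathbf u)\le 0$ ($j=1,\dots,n_g$), $\mathbf u^L\preceq\mathbf u\preceq\mathbf u^U$ ($\preceq,\prec$ are componentwise). Let $\mathcal I=\{\mathbf u:\mathbf u^L\preceq\mathbf u\preceq\mathbf u^U\}$. Standing assumptions: $\phi_p$, all $g_{p,j}$ and all $g_j$ are $C^2$ on an open set containing $\mathcal I$; the initial point $\mathbf u_0\in\mathcal I$ satisfies $g_{p,j}(\mathbf u_0)<0$ for all $j=1,\dots,n_{g_p}$ and $g_j(\mathbf u_0)\le0$ for all $j=1,\dots,n_g$. Lipschitz constants: $\kappa_{p,ji}$ and $M_{\phi,i_1i_2}$ are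 fixed constants with $-\kappa_{p,ji}<\partial g_{p,j}/\partial u_i|_{\mathbf u}<\kappa_{p,ji}$ and $-M_{\phi,i_1i_2}<\partial^2\phi_p/\partial u_{i_2}\partial u_{i_1}|_{\mathbf u}<M_{\phi,i_1i_2}$ for all $\mathbf u\in\mathcal I$. Projection parameters: strictly positive vectors $\boldsymbol\epsilon_p=(\epsilon_{p,j})$, $\boldsymbol\delta_{g_p}=(\delta_{g_p,j})$ in $\mathbb R^{n_{g_p}}$, $\boldsymbol\epsilon=(\epsilon_j)$, $\boldsymbol\delta_g=(\delta_{g,j})$ in $\mathbb R^{n_g}$, and a scalar $\delta_\phi>0$, kept fixed during one run of the scheme. The point $\mathbf u_\infty$ depends on the choice of these parameters; the limit in the claim is over all parameters tending to zero through strictly positive values. Projection problem at iteration $k$: given $\mathbf u_k$ and an arbitrary target $\mathbf u_{k+1}^*\in\mathbb R^{n_u}$, the projected target $\bar{\mathbf u}_{k+1}^*$ (components $\bar u_{k+1,i}^*$) is the minimizer of $\|\mathbf u-\mathbf u_{k+1}^*\|_2^2$ subject to - $\nabla g_{p,j}(\mathbf u_k)^T(\mathbf u-\mathbf u_k)\le-\delta_{g_p,j}$ for all $j$ with $g_{p,j}(\mathbf u_k)\ge-\epsilon_{p,j}$, - $\nabla g_j(\mathbf u_k)^T(\mathbf u-\mathbf u_k)\le-\delta_{g,j}$ for all $j$ with $g_j(\mathbf u_k)\ge-\epsilon_j$, - $\nabla\phi_p(\mathbf u_k)^T(\mathbf u-\mathbf u_k)\le-\delta_\phi$, - $\mathbf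 u^L\preceq\mathbf u\preceq\mathbf u^U$. Gain conditions on $K_k\in[0,1]$: (i) $g_{p,j}(\mathbf u_k)+K_k\sum_{i=1}^{n_u}\kappa_{p,ji}|\bar u_{k+1,i}^*-u_{k,i}|\le0$ for all $j=1,\dots,n_{g_p}$; (ii) $g_j(\mathbf u_k+K_k(\bar{\mathbf u}_{k+1}^*-\mathbf u_k))\le0$ for all $j=1,\dots,n_g$; (iii) $\nabla\phi_p(\mathbf u_k)^T(\bar{\mathbf u}_{k+1}^*-\mathbf u_k)+\frac{K_k}{2}\sum_{i_1,i_2=1}^{n_u}M_{\phi,i_1i_2}|(\bar u_{k+1,i_1}^*-u_{k,i_1})(\bar u_{k+1,i_2}^*-u_{k,i_2})|\le0$. Fritz John (FJ) error metric: for multipliers $\mu_\phi\in\mathbb R_+$, $\boldsymbol\mu_p\in\mathbb R_+^{n_{g_p}}$, $\boldsymbol\mu\in\mathbb R_+^{n_g}$, $\boldsymbol\zeta^L,\boldsymbol\zeta^U\in\mathbb R_+^{n_u}$, collected in the vector $\boldsymbol\mu_{all}=(\mu_\phi,\boldsymbol\mu_p,\boldsymbol\mu,\boldsymbol\zeta^L,\boldsymbol\zeta^U)$, put $$\nabla\mathcal L(\mathbf u)=\mu_\phi\nabla\phi_p(\mathbf u)+\sum_{j=1}^{n_{g_p}}\mu_{p,j}\nabla g_{p,j}(\mathbf u)+\sum_{j=1}^{n_g}\mu_j\nabla g_j(\mathbf u)-\boldsymbol\zeta^L+\boldsymbol\zeta^U,$$ and, for any fixed standard norm $\|\cdot\|$,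 $$\mathcal E(\mathbf u)=\min_{\boldsymbol\mu_{all}\succeq\mathbf 0,\ \|\boldsymbol\mu_{all}\|=1}\Big(\nabla\mathcal L(\mathbf u)^T\nabla\mathcal L(\mathbf u)+\sum_{j=1}^{n_{g_p}}[\mu_{p,j}g_{p,j}(\mathbf u)]^2+\sum_{j=1}^{n_g}[\mu_jg_j(\mathbf u)]^2+\sum_{i=1}^{n_u}\big[(\zeta_i^L(u_i^L-u_i))^2+(\zeta_i^U(u_i-u_i^U))^2\big]\Big).$$ *)

theory Defs
  imports "HOL-Analysis.Analysis"
begin

text \<open>
  The number of variables is the cardinality of the type 'n.  The two families of constraints are
  indexed by subsets exp_idx and num_idx of finite types 'p and 'g, so that either
  family may be empty.  Components of parameter vectors outside these index sets are irrelevant.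
\<close>

record ('n, 'p, 'g) opt_problem =
  cost :: "real ^ 'n \<Rightarrow> real"
  exp_con :: "'p \<Rightarrow> real ^ 'n \<Rightarrow> real"
  exp_idx :: "'p set"
  num_con :: "'g \<Rightarrow> real ^ 'n \<Rightarrow> real"
  num_idx :: "'g set"
  lower :: "real ^ 'n"
  upper :: "real ^ 'n"

definition box_of :: "('n::finite, 'p, 'g) opt_problem \<Rightarrow> (real ^ 'n) set" where
  "box_of P = {u. \<forall>i. lower P $ i \<le> u $ i \<and> u $ i \<le> upper P $ i}"


section \<open>Derivatives\<close>

text \<open>The Frechet derivative in the direction of a coordinate axis is the partial derivative
  wherever the function is differentiable; it is only used on sets where C2_on holds.\<close>

definition partial :: "'n::finite \<Rightarrow> (real ^ 'n \<Rightarrow> real) \<Rightarrow> real ^ 'n \<Rightarrow> real" where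
  "partial i f u = frechet_derivative f (at u) (axis i 1)"

definition grad :: "(real ^ 'n::finite \<Rightarrow> real) \<Rightarrow> real ^ 'n \<Rightarrow> real ^ 'n" where
  "grad f u = (\<chi> i. partial i f u)"

definition C2_on :: "(real ^ 'n::finite) set \<Rightarrow> (real ^ 'n \<Rightarrow> real) \<Rightarrow> bool" where
  "C2_on S f \<longleftrightarrow> open S \<and>
     (\<forall>u\<in>S. f differentiable (at u)) \<and>
     (\<forall>i. \<forall>u\<in>S. partial i f differentiable (at u)) \<and>
     (\<forall>i j. continuous_on S (partial j (partial i f)))"


section \<open>The project-and-filter scheme\<close>

text \<open>A parameter is a tuple
  (\<open>\<epsilon>\<^sub>p\<close>, \<open>\<epsilon>\<close>, \<open>\<delta>\<close> for the exp_con, \<open>\<delta>\<close> for the num_con, \<open>\<delta>\<close> for the cost).\<close>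

type_synonym ('p, 'g) proj_params =
  "(real ^ 'p) \<times> (real ^ 'g) \<times> (real ^ 'p) \<times> (real ^ 'g) \<times> real"

definition positive_params :: "('p::finite, 'g::finite) proj_params set" where
  "positive_params = {(ep, e, dp, d, dphi).
     (\<forall>j. 0 < ep $ j) \<and> (\<forall>j. 0 < e $ j) \<and> (\<forall>j. 0 < dp $ j) \<and> (\<forall>j. 0 < d $ j) \<and> 0 < dphi}"

fun proj_set :: "('n::finite, 'p::finite, 'g::finite) opt_problem \<Rightarrow> ('p, 'g) proj_params \<Rightarrow>
    real ^ 'n \<Rightarrow> (real ^ 'n) set" where
  "proj_set P (ep, e, dp, d, dphi) uk =
    {u \<in> box_of P.
       (\<forall>j\<in>exp_idx P. exp_con P j uk \<ge> - (ep $ j) \<longrightarrow>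
          grad (exp_con P j) uk \<bullet> (u - uk) \<le> - (dp $ j)) \<and>
       (\<forall>j\<in>num_idx P. num_con P j uk \<ge> - (e $ j) \<longrightarrow>
          grad (num_con P j) uk \<bullet> (u - uk) \<le> - (d $ j)) \<and>
       grad (cost P) uk \<bullet> (u - uk) \<le> - dphi}"

definition is_projection :: "('n::finite, 'p::finite, 'g::finite) opt_problem \<Rightarrow>
    ('p, 'g) proj_params \<Rightarrow> real ^ 'n \<Rightarrow> real ^ 'n \<Rightarrow> real ^ 'n \<Rightarrow> bool" where
  "is_projection P prm uk target ubar \<longleftrightarrow>
     is_arg_min (\<lambda>u. (norm (u - target))\<^sup>2) (\<lambda>u. u \<in> proj_set P prm uk) ubar"

definition gains :: "('n::finite, 'p::finite, 'g::finite) opt_problem \<Rightarrow> ('p \<Rightarrow> 'n \<Rightarrow> real) \<Rightarrow>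
    ('n \<Rightarrow> 'n \<Rightarrow> real) \<Rightarrow> real ^ 'n \<Rightarrow> real ^ 'n \<Rightarrow> real set" where
  "gains P \<kappa> M uk ubar = {K \<in> {0..1}.
     (\<forall>j\<in>exp_idx P. exp_con P j uk + K * (\<Sum>i\<in>UNIV. \<kappa> j i * \<bar>ubar $ i - uk $ i\<bar>) \<le> 0) \<and>
     (\<forall>j\<in>num_idx P. num_con P j (uk + K *\<^sub>R (ubar - uk)) \<le> 0) \<and>
     grad (cost P) uk \<bullet> (ubar - uk)
       + K / 2 * (\<Sum>i1\<in>UNIV. \<Sum>i2\<in>UNIV. M i1 i2 * \<bar>(ubar $ i1 - uk $ i1) * (ubar $ i2 - uk $ i2)\<bar>) \<le> 0}"

definition scheme_run :: "('n::finite, 'p::finite, 'g::finite) opt_problem \<Rightarrow>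
    ('p \<Rightarrow> 'n \<Rightarrow> real) \<Rightarrow> ('n \<Rightarrow> 'n \<Rightarrow> real) \<Rightarrow> real ^ 'n \<Rightarrow> ('p, 'g) proj_params \<Rightarrow>
    (nat \<Rightarrow> real ^ 'n) \<Rightarrow> (nat \<Rightarrow> real ^ 'n) \<Rightarrow> bool" where
  "scheme_run P \<kappa> M u0 prm target u \<longleftrightarrow> u 0 = u0 \<and>
     (\<forall>k. if proj_set P prm (u k) \<noteq> {}
          then \<exists>ubar K. is_projection P prm (u k) (target (Suc k)) ubar \<and>
                 K \<in> gains P \<kappa> M (u k) ubar \<and> (\<forall>K'\<in>gains P \<kappa> M (u k) ubar. K' \<le> K) \<and>
                 u (Suc k) = u k + K *\<^sub>R (ubar - u k)
          else u (Suc k) = u k)"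

text \<open>Only meaningful if the projection problem becomes infeasible at some iteration.\<close>

definition first_infeasible :: "('n::finite, 'p::finite, 'g::finite) opt_problem \<Rightarrow>
    ('p, 'g) proj_params \<Rightarrow> (nat \<Rightarrow> real ^ 'n) \<Rightarrow> nat" where
  "first_infeasible P prm u = (LEAST k. proj_set P prm (u k) = {})"


section \<open>Fritz John error\<close>

definition is_norm :: "('a::real_vector \<Rightarrow> real) \<Rightarrow> bool" where
  "is_norm N \<longleftrightarrow> (\<forall>x. 0 \<le> N x) \<and> (\<forall>x. N x = 0 \<longleftrightarrow> x = 0) \<and>
     (\<forall>c x. N (c *\<^sub>R x) = \<bar>c\<bar> * N x) \<and> (\<forall>x y. N (x + y) \<le> N x + N y)"

text \<open>Multipliers (\<open>\<mu>\<^sub>\<phi>\<close>, \<open>\<mu>\<^sub>p\<close>, \<open>\<mu>\<close>, \<open>\<zeta>\<^sup>L\<close>, \<open>\<zeta>\<^sup>U\<close>).\<close>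

type_synonym ('n, 'p, 'g) multipliers =
  "real \<times> (real ^ 'p) \<times> (real ^ 'g) \<times> (real ^ 'n) \<times> (real ^ 'n)"

text \<open>Components outside the constraint index sets are forced to vanish, so only multipliers of
  actual constraints contribute to the norm N.\<close>

definition unit_multipliers :: "('n::finite, 'p::finite, 'g::finite) opt_problem \<Rightarrow>
    (('n, 'p, 'g) multipliers \<Rightarrow> real) \<Rightarrow> ('n, 'p, 'g) multipliers set" where
  "unit_multipliers P N = {(mphi, mp, m, zL, zU).
     0 \<le> mphi \<and> (\<forall>j. 0 \<le> mp $ j) \<and> (\<forall>j. 0 \<le> m $ j) \<and> (\<forall>i. 0 \<le> zL $ i) \<and> (\<forall>i. 0 \<le> zU $ i) \<and>
     (\<forall>j. j \<notin> exp_idx P \<longrightarrow> mp $ j = 0) \<and> (\<forall>j. j \<notin> num_idx P \<longrightarrow> m $ j = 0) \<and>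
     N (mphi, mp, m, zL, zU) = 1}"

fun grad_lagrangian :: "('n::finite, 'p::finite, 'g::finite) opt_problem \<Rightarrow> real ^ 'n \<Rightarrow>
    ('n, 'p, 'g) multipliers \<Rightarrow> real ^ 'n" where
  "grad_lagrangian P u (mphi, mp, m, zL, zU) =
     mphi *\<^sub>R grad (cost P) u + (\<Sum>j\<in>exp_idx P. (mp $ j) *\<^sub>R grad (exp_con P j) u)
       + (\<Sum>j\<in>num_idx P. (m $ j) *\<^sub>R grad (num_con P j) u) - zL + zU"

fun FJ_residual :: "('n::finite, 'p::finite, 'g::finite) opt_problem \<Rightarrow> real ^ 'n \<Rightarrow>
    ('n, 'p, 'g) multipliers \<Rightarrow> real" where
  "FJ_residual P u (mphi, mp, m, zL, zU) =
     grad_lagrangian P u (mphi, mp, m, zL, zU) \<bullet> grad_lagrangian P u (mphi, mp, m, zL, zU)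
       + (\<Sum>j\<in>exp_idx P. (mp $ j * exp_con P j u)\<^sup>2)
       + (\<Sum>j\<in>num_idx P. (m $ j * num_con P j u)\<^sup>2)
       + (\<Sum>i\<in>UNIV. (zL $ i * (lower P $ i - u $ i))\<^sup>2 + (zU $ i * (u $ i - upper P $ i))\<^sup>2)"

text \<open>For every norm N this infimum is a minimum, see \<open>FJ_error_attained\<close> below.\<close>

definition FJ_error :: "('n::finite, 'p::finite, 'g::finite) opt_problem \<Rightarrow>
    (('n, 'p, 'g) multipliers \<Rightarrow> real) \<Rightarrow> real ^ 'n \<Rightarrow> real" where
  "FJ_error P N u = (INF m \<in> unit_multipliers P N. FJ_residual P u m)"

lemma is_normD:
  assumes "is_norm N"
  shows "0 \<le> N x" "N x = 0 \<longleftrightarrow> x = 0" "N (c *\<^sub>R x) = \<bar>c\<bar> * N x"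
    "N (x + y) \<le> N x + N y"
  using assms unfolding is_norm_def by blast+

lemma is_norm_pos: "is_norm N \<Longrightarrow> x \<noteq> 0 \<Longrightarrow> 0 < N x"
  by (metis is_normD(1,2) order_le_less)

lemma is_norm_continuous:
  fixes N :: "'a::euclidean_space \<Rightarrow> real"
  assumes "is_norm N"
  shows "continuous_on UNIV N"
proof -
  have "convex_on UNIV N"
  proof (rule convex_onI)
    fix t :: real and x y :: 'a
    assume t: "0 < t" "t < 1"
    have "N ((1 - t) *\<^sub>R x + t *\<^sub>R y) \<le> N ((1 - t) *\<^sub>R x) + N (t *\<^sub>R y)"
      by (rule is_normD(4)[OF assms])
    also have "\<dots> = (1 - t) * N x + t * N y"
      using t by (simp add: is_normD(3)[OF assms])
    finally show "N ((1 - t) *\<^sub>R x + t *\<^sub>R y) \<le> (1 - t) * N x + t * N y" .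
  qed auto
  then show ?thesis
    by (rule convex_on_continuous[OF open_UNIV])
qed

lemma is_norm_lower_bound:
  fixes N :: "'a::euclidean_space \<Rightarrow> real"
  assumes N: "is_norm N"
  obtains c where "c > 0" "\<And>x. c * norm x \<le> N x"
proof -
  have "\<exists>x\<in>sphere (0::'a) 1. \<forall>y\<in>sphere 0 1. N x \<le> N y"
  proof (rule continuous_attains_inf)
    show "continuous_on (sphere 0 1) N"
      using is_norm_continuous[OF N] continuous_on_subset by blast
  qed auto
  then obtain x0 where x0: "norm x0 = 1" "\<And>y. norm y = 1 \<Longrightarrow> N x0 \<le> N y"
    by auto
  have "x0 \<noteq> 0" using x0(1) by auto
  then have pos: "N x0 > 0" by (rule is_norm_pos[OF N])
  have "N x0 * norm x \<le> N x" for x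
  proof (cases "x = 0")
    case True
    then show ?thesis by (simp add: is_normD(1)[OF N])
  next
    case False
    let ?y = "(1 / norm x) *\<^sub>R x"
    have "N x = norm x * N ?y"
      using False by (simp add: is_normD(3)[OF N])
    moreover have "N x0 \<le> N ?y"
      by (rule x0(2)) (use False in simp)
    ultimately show ?thesis
      by (metis mult.commute mult_left_mono norm_ge_zero)
  qed
  with pos that show ?thesis by blast
qed

lemma compact_unit_multipliers:
  fixes P :: "('n::finite, 'p::finite, 'g::finite) opt_problem"
  assumes N: "is_norm N"
  shows "compact (unit_multipliers P N)"
proof -
  obtain c where c: "c > 0" "\<And>x. c * norm x \<le> N x"
    using is_norm_lower_bound[OF N] by blast
  have "norm x \<le> 1 / c" if "x \<in> unit_multipliers P N" for x
  proof -
    have "c * norm x \<le> 1"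
      using that c(2)[of x] by (auto simp: unit_multipliers_def)
    then show ?thesis using c(1) by (simp add: field_simps)
  qed
  then have "bounded (unit_multipliers P N)"
    unfolding bounded_iff by blast
  moreover have "closed (unit_multipliers P N)"
  proof -
    have *: "unit_multipliers P N = {x. 0 \<le> fst x \<and> (\<forall>j. 0 \<le> fst (snd x) $ j) \<and>
       (\<forall>j. 0 \<le> fst (snd (snd x)) $ j) \<and> (\<forall>i. 0 \<le> fst (snd (snd (snd x))) $ i) \<and>
       (\<forall>i. 0 \<le> snd (snd (snd (snd x))) $ i) \<and>
       (\<forall>j. j \<notin> exp_idx P \<longrightarrow> fst (snd x) $ j = 0) \<and>
       (\<forall>j. j \<notin> num_idx P \<longrightarrow> fst (snd (snd x)) $ j = 0) \<and> N x = 1}"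
      by (auto simp: unit_multipliers_def)
    show ?thesis
      unfolding *
      by (intro closed_Collect_conj closed_Collect_all closed_Collect_imp closed_Collect_le
          closed_Collect_eq continuous_intros is_norm_continuous[OF N]) auto
  qed
  ultimately show ?thesis
    by (simp add: compact_eq_bounded_closed)
qed

lemma FJ_error_attained:
  fixes P :: "('n::finite, 'p::finite, 'g::finite) opt_problem"
  assumes N: "is_norm N"
  shows "\<exists>m\<in>unit_multipliers P N. FJ_error P N u = FJ_residual P u m
           \<and> (\<forall>m'\<in>unit_multipliers P N. FJ_residual P u m \<le> FJ_residual P u m')"
proof -
  let ?e = "(1, 0, 0, 0, 0) :: ('n, 'p, 'g) multipliers"
  have pos: "N ?e > 0"
  proof -
    have "?e \<noteq> 0" by (simp add: zero_prod_def)
    then show ?thesis by (rule is_norm_pos[OF N])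
  qed
  have "N ((1 / N ?e) *\<^sub>R ?e) = 1"
    unfolding is_normD(3)[OF N] using pos by simp
  then have "(1 / N ?e) *\<^sub>R ?e \<in> unit_multipliers P N"
    using pos by (simp add: unit_multipliers_def)
  then have ne: "unit_multipliers P N \<noteq> {}" by blast
  have eq: "FJ_residual P u = (\<lambda>x.
     (fst x *\<^sub>R grad (cost P) u + (\<Sum>j\<in>exp_idx P. (fst (snd x) $ j) *\<^sub>R grad (exp_con P j) u)
       + (\<Sum>j\<in>num_idx P. (fst (snd (snd x)) $ j) *\<^sub>R grad (num_con P j) u)
       - fst (snd (snd (snd x))) + snd (snd (snd (snd x)))) \<bullet>
     (fst x *\<^sub>R grad (cost P) u + (\<Sum>j\<in>exp_idx P. (fst (snd x) $ j) *\<^sub>R grad (exp_con P j) u)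
       + (\<Sum>j\<in>num_idx P. (fst (snd (snd x)) $ j) *\<^sub>R grad (num_con P j) u)
       - fst (snd (snd (snd x))) + snd (snd (snd (snd x))))
     + (\<Sum>j\<in>exp_idx P. (fst (snd x) $ j * exp_con P j u)\<^sup>2)
     + (\<Sum>j\<in>num_idx P. (fst (snd (snd x)) $ j * num_con P j u)\<^sup>2)
     + (\<Sum>i\<in>UNIV. (fst (snd (snd (snd x))) $ i * (lower P $ i - u $ i))\<^sup>2
          + (snd (snd (snd (snd x))) $ i * (u $ i - upper P $ i))\<^sup>2))"
    by (rule ext) (auto simp: split_paired_all)
  have "continuous_on (unit_multipliers P N) (FJ_residual P u)"
    unfolding eq by (intro continuous_intros)
  with continuous_attains_inf[OF compact_unit_multipliers[OF N] ne]
  obtain m where m: "m \<in> unit_multipliers P N"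
    "\<And>m'. m' \<in> unit_multipliers P N \<Longrightarrow> FJ_residual P u m \<le> FJ_residual P u m'"
    by blast
  have "FJ_error P N u = FJ_residual P u m"
    unfolding FJ_error_def by (rule cInf_eq_minimum) (use m in auto)
  with m show ?thesis by blast
qed

end

theory Submission
  imports Defs
begin

text \<open>Two things have to be shown: every run reaches an infeasible projection problem, and the points
  where this happens have vanishing Fritz John error as the parameters vanish.

  \<^emph>\<open>Why a run stops.\<close>  The bounds \<open>\<kappa>\<close> and \<open>M\<close> are strict, so on the compact box the
  derivatives stay below \<open>\<theta> \<kappa>\<close> and \<open>\<theta> M\<close> for one \<open>\<theta> < 1\<close>
  (\<open>strict_bounds_have_slack\<close>).  The gain condition for an experimental constraint bounds the
  possible increase computed with \<open>\<kappa>\<close>, hence the actual increase uses up at most the fraction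
  \<open>\<theta>\<close> of the distance to zero.  A point with a sizeable margin therefore cannot lose all
  of it in one step; a point with a tiny margin only admits a tiny gain, and then the strict
  first-order decrease demanded by the projection outweighs the curvature, so that the margin does
  not shrink at all.  Together the margins stay bounded away from zero during the whole run
  (\<open>exp_con_keeps_margin\<close>).  Given such a margin, one positive gain satisfies all three gain
  conditions at every iterate (\<open>uniform_gain\<close>), so the maximal gains are bounded below, and the
  slack in \<open>M\<close> turns this into a cost decrease bounded below (\<open>cost_step_decrease\<close>).
  An infinite run would drive the cost, which is bounded on the box, to minus infinity.

  \<^emph>\<open>Why the error vanishes.\<close>  Otherwise there are parameters tending to zero and strictly feasible
  points with infeasible projection problems whose errors stay away from zero; by compactness the
  points converge along a subsequence.  At the limit no direction into the box strictly decreases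
  the cost and all active constraints: such a direction would, by continuity, solve the
  projection problems close to the limit (\<open>infeasible_limit_is_stuck\<close>).  A theorem of the
  alternative for convex functions (\<open>convex_strict_alternative\<close>) then gives multipliers with
  zero residual at the limit (\<open>fritz_john_multipliers\<close>).  The same multipliers have a small
  residual at the nearby points, and the error is the minimum over all multipliers: a contradiction.\<close>

section \<open>Twice continuously differentiable functions along segments\<close>

lemma has_derivative_grad:
  assumes "f differentiable (at u)"
  shows "(f has_derivative (\<lambda>h. grad f u \<bullet> h)) (at u)"
proof -
  let ?D = "frechet_derivative f (at u)"
  have D: "(f has_derivative ?D) (at u)"
    using assms frechet_derivative_works by blast
  then have lin: "linear ?D" by (rule has_derivative_linear)
  have "?D h = grad f u \<bullet> h" for h
  proof -
    have "?D h = ?D (\<Sum>i\<in>UNIV. h $ i *\<^sub>R axis i 1)"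
      by (simp add: basis_expansion flip: scalar_mult_eq_scaleR)
    also have "\<dots> = (\<Sum>i\<in>UNIV. h $ i * ?D (axis i 1))"
      by (simp add: linear_sum[OF lin] linear_cmul[OF lin])
    also have "\<dots> = grad f u \<bullet> h"
      by (simp add: inner_vec_def grad_def partial_def mult.commute)
    finally show ?thesis .
  qed
  then have "?D = (\<lambda>h. grad f u \<bullet> h)" by blast
  with D show ?thesis by simp
qed

lemma has_real_derivative_along_line:
  assumes "f differentiable (at (u + t *\<^sub>R d))"
  shows "((\<lambda>t. f (u + t *\<^sub>R d)) has_real_derivative grad f (u + t *\<^sub>R d) \<bullet> d) (at t)"
proof -
  have "((\<lambda>t. u + t *\<^sub>R d) has_derivative (\<lambda>h. h *\<^sub>R d)) (at t)"
    by (auto intro!: derivative_eq_intros)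
  from has_derivative_compose[OF this has_derivative_grad[OF assms]]
  show ?thesis
    by (simp add: has_field_derivative_def mult_commute_abs)
qed

lemma C2_onD:
  assumes "C2_on S f" "u \<in> S"
  shows "f differentiable (at u)" "partial i f differentiable (at u)"
  using assms unfolding C2_on_def by auto

lemma C2_on_continuous:
  assumes "C2_on S f"
  shows "continuous_on S f" "continuous_on S (grad f)" "continuous_on S (partial i f)"
    "continuous_on S (partial j (partial i f))"
proof -
  show "continuous_on S f" 
    using C2_onD(1)[OF assms] differentiable_imp_continuous_within continuous_at_imp_continuous_on
    by blast
  have *: "continuous_on S (partial i f)" for i
    using C2_onD(2)[OF assms] differentiable_imp_continuous_within continuous_at_imp_continuous_on
    by blast
  then show "continuous_on S (partial i f)" .
  have "continuous_on S (\<lambda>u. \<chi> i. partial i f u)"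
    by (rule continuous_on_vec_lambda) (rule *)
  then show "continuous_on S (grad f)" by (simp add: grad_def[abs_def])
  show "continuous_on S (partial j (partial i f))"
    using assms by (simp add: C2_on_def)
qed

lemma inner_grad: "grad f u \<bullet> d = (\<Sum>i\<in>UNIV. partial i f u * d $ i)"
  by (simp add: inner_vec_def grad_def)

lemma line_in_convex:
  fixes u v :: "'a::real_vector"
  assumes "convex X" "u \<in> X" "v \<in> X" "0 \<le> K" "K \<le> 1"
  shows "u + K *\<^sub>R (v - u) \<in> X"
  using convexD[OF assms(1-3), of "1 - K" K] assms(4,5) by (simp add: algebra_simps)

text \<open>The mean value theorem along the segment, with every partial derivative replaced by its bound;
  this is the estimate behind the gain condition for the experimental constraints.\<close>

lemma C2_on_first_order_bound:
  assumes f: "C2_on S f" and X: "convex X" "X \<subseteq> S" and uv: "u \<in> X" "v \<in> X"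
    and K: "0 \<le> K" "K \<le> 1"
    and c: "\<And>i w. w \<in> X \<Longrightarrow> \<bar>partial i f w\<bar> \<le> c i"
  shows "f (u + K *\<^sub>R (v - u)) \<le> f u + K * (\<Sum>i\<in>UNIV. c i * \<bar>v $ i - u $ i\<bar>)"
proof (cases "K = 0")
  case False
  let ?d = "v - u"
  have X': "u + t *\<^sub>R ?d \<in> X" if "0 \<le> t" "t \<le> K" for t
    using line_in_convex[OF X(1) uv] that K by simp
  have "\<exists>t>0. t < K \<and> f (u + K *\<^sub>R ?d) - f (u + 0 *\<^sub>R ?d) = (K - 0) * (grad f (u + t *\<^sub>R ?d) \<bullet> ?d)"
    by (rule MVT2) (use False K X' X C2_onD[OF f] in \<open>auto intro!: has_real_derivative_along_line\<close>)
  then obtain t where t: "0 < t" "t < K"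
    "f (u + K *\<^sub>R ?d) = f u + K * (grad f (u + t *\<^sub>R ?d) \<bullet> ?d)" by auto
  have "grad f (u + t *\<^sub>R ?d) \<bullet> ?d \<le> (\<Sum>i\<in>UNIV. c i * \<bar>v $ i - u $ i\<bar>)"
    unfolding inner_grad
  proof (rule sum_mono)
    fix i
    have "partial i f (u + t *\<^sub>R ?d) * ?d $ i \<le> \<bar>partial i f (u + t *\<^sub>R ?d)\<bar> * \<bar>?d $ i\<bar>"
      by (metis abs_ge_self abs_mult)
    also have "\<dots> \<le> c i * \<bar>v $ i - u $ i\<bar>"
      using c X' t unfolding vector_minus_component by (intro mult_right_mono) auto
    finally show "partial i f (u + t *\<^sub>R ?d) * ?d $ i \<le> c i * \<bar>v $ i - u $ i\<bar>" .
  qed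
  then show ?thesis using t(3) K by (simp add: mult_left_mono)
qed simp

text \<open>Taylor's formula of order two along the segment; this is the estimate behind the gain condition
  for the cost.\<close>

lemma C2_on_second_order_bound:
  assumes f: "C2_on S f" and X: "convex X" "X \<subseteq> S" and uv: "u \<in> X" "v \<in> X"
    and K: "0 \<le> K" "K \<le> 1"
    and c: "\<And>i j w. w \<in> X \<Longrightarrow> \<bar>partial j (partial i f) w\<bar> \<le> c i j"
  shows "f (u + K *\<^sub>R (v - u)) \<le> f u + K * (grad f u \<bullet> (v - u))
    + K\<^sup>2 / 2 * (\<Sum>i\<in>UNIV. \<Sum>j\<in>UNIV. c i j * \<bar>(v $ i - u $ i) * (v $ j - u $ j)\<bar>)"
proof (cases "K = 0")
  case False
  let ?d = "v - u"
  \<comment> \<open>the derivatives of order 0, 1 and 2 of the restriction to the segment\<close>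
  define D where "D m t = (if m = 0 then f (u + t *\<^sub>R ?d)
    else if m = 1 then grad f (u + t *\<^sub>R ?d) \<bullet> ?d
    else \<Sum>i\<in>UNIV. (grad (partial i f) (u + t *\<^sub>R ?d) \<bullet> ?d) * ?d $ i)" for m :: nat and t
  have X': "u + t *\<^sub>R ?d \<in> X" if "0 \<le> t" "t \<le> K" for t
    using line_in_convex[OF X(1) uv] that K by simp
  have "\<exists>t>0. t < K \<and> f (u + K *\<^sub>R ?d) =
      (\<Sum>m<2. D m 0 / fact m * K ^ m) + D 2 t / fact 2 * K ^ 2"
  proof (rule Maclaurin)
    show "\<forall>m t. m < 2 \<and> 0 \<le> t \<and> t \<le> K \<longrightarrow> (D m has_real_derivative D (Suc m) t) (at t)"
    proof safe
      fix m :: nat and t :: real assume m: "m < 2" and t: "0 \<le> t" "t \<le> K"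
      have S: "u + t *\<^sub>R ?d \<in> S" using X X' t by blast
      from m consider "m = 0" | "m = 1" by linarith
      then show "(D m has_real_derivative D (Suc m) t) (at t)"
      proof cases
        case 1
        then show ?thesis
          using has_real_derivative_along_line[OF C2_onD(1)[OF f S]] by (simp add: D_def[abs_def])
      next
        case 2
        have "((\<lambda>t. \<Sum>i\<in>UNIV. partial i f (u + t *\<^sub>R ?d) * ?d $ i) has_real_derivative
            (\<Sum>i\<in>UNIV. (grad (partial i f) (u + t *\<^sub>R ?d) \<bullet> ?d) * ?d $ i)) (at t)"
          by (intro DERIV_sum DERIV_cmult_right has_real_derivative_along_line C2_onD(2)[OF f S])
        then show ?thesis using 2 by (simp add: D_def[abs_def] inner_grad[of f])
      qed
    qed
  qed (use False K in \<open>auto simp: D_def\<close>)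
  then obtain t where t: "0 < t" "t < K"
    "f (u + K *\<^sub>R ?d) = f u + K * (grad f u \<bullet> ?d) + K\<^sup>2 / 2 * D 2 t"
    by (auto simp: D_def[of 0] D_def[of "Suc 0"] numeral_2_eq_2 mult.commute)
  have "D 2 t = (\<Sum>i\<in>UNIV. \<Sum>j\<in>UNIV. partial j (partial i f) (u + t *\<^sub>R ?d) * (?d $ i * ?d $ j))"
    by (simp add: D_def inner_grad sum_distrib_left sum_distrib_right mult_ac)
  also have "\<dots> \<le> (\<Sum>i\<in>UNIV. \<Sum>j\<in>UNIV. c i j * \<bar>(v $ i - u $ i) * (v $ j - u $ j)\<bar>)"
  proof (intro sum_mono)
    fix i j
    have "partial j (partial i f) (u + t *\<^sub>R ?d) * (?d $ i * ?d $ j)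
      \<le> \<bar>partial j (partial i f) (u + t *\<^sub>R ?d)\<bar> * \<bar>?d $ i * ?d $ j\<bar>"
      by (metis abs_ge_self abs_mult)
    also have "\<dots> \<le> c i j * \<bar>(v $ i - u $ i) * (v $ j - u $ j)\<bar>"
      using c X' t unfolding vector_minus_component by (intro mult_right_mono) auto
    finally show "partial j (partial i f) (u + t *\<^sub>R ?d) * (?d $ i * ?d $ j)
      \<le> c i j * \<bar>(v $ i - u $ i) * (v $ j - u $ j)\<bar>" .
  qed
  finally show ?thesis using t(3) by (simp add: mult_left_mono)
qed simp

lemma continuous_compact_abs_bound:
  fixes f :: "'a::topological_space \<Rightarrow> real"
  assumes "compact X" "continuous_on X f"
  shows "\<exists>B. \<forall>x\<in>X. \<bar>f x\<bar> \<le> B"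
proof -
  have "bounded (f ` X)"
    using assms compact_continuous_image compact_imp_bounded by blast
  then show ?thesis
    by (auto simp: bounded_iff)
qed

lemma compact_component_distance:
  fixes X :: "(real ^ 'n::finite) set"
  assumes "compact X"
  shows "\<exists>D. \<forall>u\<in>X. \<forall>v\<in>X. \<forall>i. \<bar>v $ i - u $ i\<bar> \<le> D"
proof -
  have "\<bar>v $ i - u $ i\<bar> \<le> diameter X" if "u \<in> X" "v \<in> X" for u v i
    using component_le_norm_cart[of "v - u" i]
      diameter_bounded_bound[OF compact_imp_bounded[OF assms] that(2,1)]
    by (simp add: dist_norm)
  then show ?thesis by blast
qed

text \<open>A single constant for all segments in a compact convex set, for arguments where only the order
  in \<open>K\<close> matters: the set has finite diameter and the derivatives are bounded on it.\<close>

lemma C2_on_uniform_bounds: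
  fixes f :: "real ^ 'n::finite \<Rightarrow> real"
  assumes f: "C2_on S f" and X: "convex X" "compact X" "X \<subseteq> S"
  obtains C where "0 < C"
    "\<And>u v K. \<lbrakk>u \<in> X; v \<in> X; 0 \<le> K; K \<le> 1\<rbrakk> \<Longrightarrow> f (u + K *\<^sub>R (v - u)) \<le> f u + C * K"
    "\<And>u v K. \<lbrakk>u \<in> X; v \<in> X; 0 \<le> K; K \<le> 1\<rbrakk> \<Longrightarrow>
      f (u + K *\<^sub>R (v - u)) \<le> f u + K * (grad f u \<bullet> (v - u)) + C * K\<^sup>2"
proof -
  have "\<exists>B. \<forall>x\<in>X. \<bar>partial i f x\<bar> \<le> B" for i
    by (rule continuous_compact_abs_bound[OF X(2) continuous_on_subset[OF C2_on_continuous(3)[OF f] X(3)]])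
  then obtain b where b: "\<And>i x. x \<in> X \<Longrightarrow> \<bar>partial i f x\<bar> \<le> b i" by metis
  have "\<exists>B. \<forall>x\<in>X. \<bar>partial j (partial i f) x\<bar> \<le> B" for i j
    by (rule continuous_compact_abs_bound[OF X(2) continuous_on_subset[OF C2_on_continuous(4)[OF f] X(3)]])
  then have "\<exists>B. \<forall>i j. \<forall>x\<in>X. \<bar>partial j (partial i f) x\<bar> \<le> B i j"
    by (intro choice allI)
  then obtain B where B: "\<And>i j x. x \<in> X \<Longrightarrow> \<bar>partial j (partial i f) x\<bar> \<le> B i j"
    by blast
  obtain D where D: "\<And>u v i. \<lbrakk>u \<in> X; v \<in> X\<rbrakk> \<Longrightarrow> \<bar>v $ i - u $ i\<bar> \<le> D"
    using compact_component_distance[OF X(2)] by blast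
  define C1 where "C1 = (\<Sum>i\<in>UNIV. \<bar>b i\<bar> * D)"
  define C2 where "C2 = (\<Sum>i\<in>UNIV. \<Sum>j\<in>UNIV. \<bar>B i j\<bar> * (D * D))"
  define C where "C = \<bar>C1\<bar> + \<bar>C2\<bar> + 1"
  show thesis
  proof
    show "0 < C" by (simp add: C_def)
    fix u v :: "real ^ 'n" and K :: real
    assume u: "u \<in> X" and v: "v \<in> X" and K: "0 \<le> K" "K \<le> 1"
    have "(\<Sum>i\<in>UNIV. b i * \<bar>v $ i - u $ i\<bar>) \<le> C1"
      unfolding C1_def using D[OF u v] by (intro sum_mono mult_mono) auto
    then have "(\<Sum>i\<in>UNIV. b i * \<bar>v $ i - u $ i\<bar>) \<le> C"
      by (simp add: C_def)
    from mult_left_mono[OF this K(1)]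
    show "f (u + K *\<^sub>R (v - u)) \<le> f u + C * K"
      using C2_on_first_order_bound[OF f X(1,3) u v K b] by (simp add: mult.commute)
    have D0: "0 \<le> D" using D[OF u u] by simp
    have "(\<Sum>i\<in>UNIV. \<Sum>j\<in>UNIV. B i j * \<bar>(v $ i - u $ i) * (v $ j - u $ j)\<bar>) \<le> C2"
      unfolding C2_def abs_mult using D[OF u v] D0 by (intro sum_mono mult_mono) auto
    then have "(\<Sum>i\<in>UNIV. \<Sum>j\<in>UNIV. B i j * \<bar>(v $ i - u $ i) * (v $ j - u $ j)\<bar>) \<le> 2 * C"
      by (simp add: C_def)
    from mult_left_mono[OF this, of "K\<^sup>2 / 2"]
    show "f (u + K *\<^sub>R (v - u)) \<le> f u + K * (grad f u \<bullet> (v - u)) + C * K\<^sup>2"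
      using C2_on_second_order_bound[OF f X(1,3) u v K B] by (simp add: mult.commute)
  qed
qed

text \<open>A continuous function attains its maximum on a compact set, so a strict bound leaves a gap there.
  Finitely many gaps are covered by one factor below 1.\<close>

lemma strict_bounds_have_slack:
  fixes h :: "'i \<Rightarrow> 'a::topological_space \<Rightarrow> real"
  assumes "compact X" "finite I" "\<And>i. i \<in> I \<Longrightarrow> continuous_on X (h i)"
    "\<And>i x. i \<in> I \<Longrightarrow> x \<in> X \<Longrightarrow> \<bar>h i x\<bar> < c i"
  obtains \<theta> where "0 \<le> \<theta>" "\<theta> < 1" "\<And>i x. i \<in> I \<Longrightarrow> x \<in> X \<Longrightarrow> \<bar>h i x\<bar> \<le> \<theta> * c i"
proof (cases "X = {}")
  case True
  then show thesis using that[of 0] by auto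
next
  case ne: False
  have "\<exists>\<theta>. 0 \<le> \<theta> \<and> \<theta> < 1 \<and> (\<forall>i\<in>I. \<forall>x\<in>X. \<bar>h i x\<bar> \<le> \<theta> * c i)"
    using assms(2-4)
  proof (induction I)
    case empty
    then show ?case by (intro exI[of _ 0]) auto
  next
    case (insert i I)
    then obtain \<theta> where \<theta>: "0 \<le> \<theta>" "\<theta> < 1" "\<forall>i\<in>I. \<forall>x\<in>X. \<bar>h i x\<bar> \<le> \<theta> * c i" by auto
    have "continuous_on X (\<lambda>x. \<bar>h i x\<bar>)"
      by (intro continuous_intros insert.prems) auto
    from continuous_attains_sup[OF assms(1) ne this]
    obtain x0 where x0: "x0 \<in> X" "\<And>x. x \<in> X \<Longrightarrow> \<bar>h i x\<bar> \<le> \<bar>h i x0\<bar>" by auto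
    define \<theta>' where "\<theta>' = max \<theta> (\<bar>h i x0\<bar> / c i)"
    have "\<bar>h i x0\<bar> < c i" using insert.prems x0 by auto
    then have ci: "0 < c i" by linarith
    have "\<theta>' < 1" "0 \<le> \<theta>'"
      using \<theta> ci \<open>\<bar>h i x0\<bar> < c i\<close> by (auto simp: \<theta>'_def)
    moreover have "\<bar>h i x\<bar> \<le> \<theta>' * c i" if "x \<in> X" for x
    proof -
      have "\<bar>h i x\<bar> \<le> (\<bar>h i x0\<bar> / c i) * c i" using x0 that ci by simp
      also have "\<dots> \<le> \<theta>' * c i" using ci by (intro mult_right_mono) (auto simp: \<theta>'_def)
      finally show ?thesis .
    qed
    moreover have "\<bar>h i' x\<bar> \<le> \<theta>' * c i'" if "i' \<in> I" "x \<in> X" for i' x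
    proof -
      have "\<bar>h i' x\<bar> < c i'" using insert.prems that by auto
      then have "\<theta> * c i' \<le> \<theta>' * c i'" by (intro mult_right_mono) (auto simp: \<theta>'_def)
      then show ?thesis using \<theta>(3) that by force
    qed
    ultimately show ?case by (intro exI[of _ \<theta>']) auto
  qed
  with that show thesis by metis
qed

section \<open>A theorem of the alternative for convex functions\<close>

text \<open>The values that strictly dominate some \<open>(h j u)\<^sub>j\<close> form a convex set which, if the
  strict inequalities have no common solution, does not contain the origin.  The normal of a
  hyperplane separating the two is the vector of weights: it is nonnegative because the set is
  closed under increasing a coordinate, and it vanishes outside \<open>J\<close> because those coordinates
  are unrestricted.  For linear functions this is Gordan's theorem.\<close>

lemma convex_strict_alternative:
  fixes h :: "'j::finite \<Rightarrow> 'a::real_vector \<Rightarrow> real"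
  assumes "C \<noteq> {}" and cvx: "\<And>j. j \<in> J \<Longrightarrow> convex_on C (h j)"
    and no: "\<not> (\<exists>u\<in>C. \<forall>j\<in>J. h j u < 0)"
  obtains l where "\<And>j. 0 \<le> l j" "\<And>j. j \<notin> J \<Longrightarrow> l j = 0" "\<exists>j\<in>J. l j \<noteq> 0"
    "\<And>u. u \<in> C \<Longrightarrow> 0 \<le> (\<Sum>j\<in>J. l j * h j u)"
proof -
  define Z where "Z = {z :: real ^ 'j. \<exists>u\<in>C. \<forall>j\<in>J. h j u < z $ j}"
  obtain u0 where u0: "u0 \<in> C" using assms(1) by blast
  obtain j0 where "j0 \<in> J" using no u0 by blast
  then have C: "convex C" using cvx convex_on_imp_convex by blast
  have "convex Z"
  proof (rule convexI)
    fix x y :: "real ^ 'j" and s t :: real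
    assume xy: "x \<in> Z" "y \<in> Z" and st: "0 \<le> s" "0 \<le> t" "s + t = 1"
    from xy obtain u v where u: "u \<in> C" "\<forall>j\<in>J. h j u < x $ j" and v: "v \<in> C" "\<forall>j\<in>J. h j v < y $ j"
      by (auto simp: Z_def)
    have "h j (s *\<^sub>R u + t *\<^sub>R v) < (s *\<^sub>R x + t *\<^sub>R y) $ j" if j: "j \<in> J" for j
    proof -
      have "h j (s *\<^sub>R u + t *\<^sub>R v) \<le> s * h j u + t * h j v"
        using cvx[OF j] u(1) v(1) st unfolding convex_on_def by auto
      also have "\<dots> < s * x $ j + t * y $ j"
      proof (cases "s = 0")
        case True
        then show ?thesis using v(2) j st by simp
      next
        case False
        then have "s * h j u < s * x $ j" using u(2) j st by simp
        moreover have "t * h j v \<le> t * y $ j" using v(2) j st by (simp add: mult_left_mono less_imp_le)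
        ultimately show ?thesis by linarith
      qed
      finally show ?thesis by simp
    qed
    then show "s *\<^sub>R x + t *\<^sub>R y \<in> Z"
      unfolding Z_def using convexD[OF C u(1) v(1) st] by blast
  qed
  moreover have "0 \<notin> Z" using no by (auto simp: Z_def)
  ultimately obtain a where a: "a \<noteq> 0" "\<forall>z\<in>Z. 0 \<le> a \<bullet> z"
    using separating_hyperplane_set_0 by blast
  define z0 :: "real ^ 'j" where "z0 = (\<chi> j. h j u0 + 1)"
  have above: "z \<in> Z" if "u \<in> C" "\<And>j. j \<in> J \<Longrightarrow> h j u < z $ j" for u z
    using that by (auto simp: Z_def)
  have z0: "z0 \<in> Z" by (rule above[OF u0]) (simp add: z0_def)
  \<comment> \<open>A functional that is nonnegative on a ray is nonnegative on its direction.\<close>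
  have ray: "0 \<le> a $ j * s" if s: "\<And>t. 0 \<le> t \<Longrightarrow> z0 + t *\<^sub>R axis j s \<in> Z" for j s
  proof (rule ccontr)
    assume neg: "\<not> 0 \<le> a $ j * s"
    define t where "t = (\<bar>a \<bullet> z0\<bar> + 1) / - (a $ j * s)"
    have "0 \<le> t" unfolding t_def using neg by (intro divide_nonneg_pos) auto
    then have "0 \<le> a \<bullet> (z0 + t *\<^sub>R axis j s)" using a(2) s by blast
    also have "\<dots> = a \<bullet> z0 + t * (a $ j * s)"
      by (simp add: inner_add_right inner_axis)
    also have "t * (a $ j * s) = - (\<bar>a \<bullet> z0\<bar> + 1)" using neg by (auto simp: t_def)
    finally show False by linarith
  qed
  have nonneg: "0 \<le> a $ j" for j
  proof -
    have "0 \<le> a $ j * 1"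
      by (rule ray, rule above[OF u0]) (simp add: z0_def axis_def)
    then show ?thesis by simp
  qed
  have zero: "a $ j = 0" if "j \<notin> J" for j
  proof -
    have "0 \<le> a $ j * (-1)"
      by (rule ray, rule above[OF u0]) (use that in \<open>auto simp: z0_def axis_def\<close>)
    with nonneg[of j] show ?thesis by linarith
  qed
  show thesis
  proof (rule that[of "\<lambda>j. a $ j"])
    show "\<exists>j\<in>J. a $ j \<noteq> 0" using a(1) zero by (metis vec_eq_iff zero_index)
    fix u assume u: "u \<in> C"
    \<comment> \<open>\<open>(h j u)\<^sub>j\<close> itself is only in the closure of \<open>Z\<close>: approach it from above.\<close>
    have "0 \<le> (\<Sum>j\<in>J. a $ j * h j u) + e" if e: "0 < e" for e
    proof -
      define s where "s = (\<Sum>j\<in>J. a $ j)"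
      have s: "0 \<le> s" unfolding s_def by (intro sum_nonneg nonneg)
      define t where "t = e / (s + 1)"
      have t: "0 < t" using e s by (simp add: t_def)
      have "(\<chi> j. h j u + t) \<in> Z" by (rule above[OF u]) (use t in simp)
      then have "0 \<le> a \<bullet> (\<chi> j. h j u + t)" using a(2) by blast
      also have "\<dots> = (\<Sum>j\<in>UNIV. a $ j * (h j u + t))" by (simp add: inner_vec_def)
      also have "\<dots> = (\<Sum>j\<in>J. a $ j * (h j u + t))"
        by (rule sum.mono_neutral_right) (auto simp: zero)
      also have "\<dots> = (\<Sum>j\<in>J. a $ j * h j u) + s * t"
        by (simp add: s_def algebra_simps sum.distrib sum_distrib_left)
      also have "s * t \<le> e" using e s by (simp add: t_def field_simps)
      finally show ?thesis by simp
    qed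
    then show "0 \<le> (\<Sum>j\<in>J. a $ j * h j u)" by (rule field_le_epsilon)
  qed (use nonneg zero in auto)
qed

section \<open>A run reaches an infeasible projection problem\<close>

lemma box_of_eq_cbox: "box_of P = cbox (lower P) (upper P)"
  by (auto simp: box_of_def mem_box_cart)

lemma compact_box_of: "compact (box_of P)"
  by (simp add: box_of_eq_cbox)

lemma convex_box_of: "convex (box_of P)"
  by (simp add: box_of_eq_cbox)

lemma proj_set_subset_box: "v \<in> proj_set P prm u \<Longrightarrow> v \<in> box_of P"
  by (cases prm) auto

text \<open>The invariant of a run.  Strictness matters for the experimental constraints: at a point where
  one of them vanishes, the gain condition forces the gain zero, and a run could stay there forever
  although its projection problem is feasible.\<close>

definition strictly_feasible :: "('n::finite, 'p, 'g) opt_problem \<Rightarrow> (real ^ 'n) set" where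
  "strictly_feasible P = {u \<in> box_of P. (\<forall>j\<in>exp_idx P. exp_con P j u < 0) \<and>
     (\<forall>j\<in>num_idx P. num_con P j u \<le> 0)}"

lemma eventually_small_multiple:
  fixes A b :: real
  assumes "0 < b"
  shows "\<forall>\<^sub>F K in at_right 0. K * A \<le> b"
proof -
  have "((\<lambda>K. K * A) \<longlongrightarrow> 0 * A) (at_right 0)"
    by (intro tendsto_intros)
  then have "\<forall>\<^sub>F K in at_right 0. K * A < b"
    using assms by (auto dest: order_tendstoD(2))
  then show ?thesis by (rule eventually_mono) simp
qed

locale filtered_scheme =
  fixes P :: "('n::finite, 'p::finite, 'g::finite) opt_problem"
    and \<kappa> :: "'p \<Rightarrow> 'n \<Rightarrow> real"
    and M :: "'n \<Rightarrow> 'n \<Rightarrow> real"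
  assumes cost_C2: "\<exists>S. box_of P \<subseteq> S \<and> C2_on S (cost P)"
    and exp_con_C2: "\<forall>j\<in>exp_idx P. \<exists>S. box_of P \<subseteq> S \<and> C2_on S (exp_con P j)"
    and num_con_C2: "\<forall>j\<in>num_idx P. \<exists>S. box_of P \<subseteq> S \<and> C2_on S (num_con P j)"
    and kappa: "\<forall>j\<in>exp_idx P. \<forall>i. \<forall>v\<in>box_of P.
      - \<kappa> j i < partial i (exp_con P j) v \<and> partial i (exp_con P j) v < \<kappa> j i"
    and M: "\<forall>i1 i2. \<forall>v\<in>box_of P.
      - M i1 i2 < partial i2 (partial i1 (cost P)) v \<and> partial i2 (partial i1 (cost P)) v < M i1 i2"
begin

text \<open>The gain condition says that the increase computed with \<open>\<kappa>\<close> is at most the distance of the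
  constraint to zero, and the actual increase is at most \<open>\<theta>\<close> times the computed one.\<close>

lemma exp_con_step_contraction:
  obtains \<theta> where "0 \<le> \<theta>" "\<theta> < 1"
    "\<And>j u v K. \<lbrakk>j \<in> exp_idx P; u \<in> box_of P; v \<in> box_of P; K \<in> gains P \<kappa> M u v\<rbrakk>
      \<Longrightarrow> exp_con P j (u + K *\<^sub>R (v - u)) \<le> (1 - \<theta>) * exp_con P j u"
proof -
  obtain \<theta> where \<theta>: "0 \<le> \<theta>" "\<theta> < 1"
    "\<And>ji x. ji \<in> exp_idx P \<times> UNIV \<Longrightarrow> x \<in> box_of P \<Longrightarrow>
      \<bar>partial (snd ji) (exp_con P (fst ji)) x\<bar> \<le> \<theta> * \<kappa> (fst ji) (snd ji)"
  proof (rule strict_bounds_have_slack)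
    show "compact (box_of P)" by (rule compact_box_of)
    show "continuous_on (box_of P) (partial (snd ji) (exp_con P (fst ji)))"
      if "ji \<in> exp_idx P \<times> UNIV" for ji
      using exp_con_C2 that C2_on_continuous(3) continuous_on_subset
      by (metis mem_Times_iff)
    show "\<bar>partial (snd ji) (exp_con P (fst ji)) x\<bar> < \<kappa> (fst ji) (snd ji)"
      if "ji \<in> exp_idx P \<times> UNIV" "x \<in> box_of P" for ji x
      using kappa that by (auto simp: abs_less_iff minus_less_iff)
  qed auto
  show thesis
  proof (rule that[OF \<theta>(1,2)])
    fix j u v K
    assume j: "j \<in> exp_idx P" and u: "u \<in> box_of P" and v: "v \<in> box_of P"
      and K: "K \<in> gains P \<kappa> M u v"
    let ?X = "K * (\<Sum>i\<in>UNIV. \<kappa> j i * \<bar>v $ i - u $ i\<bar>)"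
    obtain S where S: "box_of P \<subseteq> S" "C2_on S (exp_con P j)"
      using exp_con_C2 j by blast
    have K': "0 \<le> K" "K \<le> 1" "exp_con P j u + ?X \<le> 0"
      using K j by (auto simp: gains_def)
    have "exp_con P j (u + K *\<^sub>R (v - u))
      \<le> exp_con P j u + K * (\<Sum>i\<in>UNIV. \<theta> * \<kappa> j i * \<bar>v $ i - u $ i\<bar>)"
      using \<theta>(3)[of "(j, _)"] j
      by (intro C2_on_first_order_bound[OF S(2) convex_box_of S(1) u v K'(1,2)]) auto
    also have "\<dots> = exp_con P j u + \<theta> * ?X"
      by (simp add: sum_distrib_left mult_ac)
    also have "\<dots> \<le> exp_con P j u + \<theta> * (- exp_con P j u)"
      using K'(3) \<theta>(1) by (intro add_left_mono mult_left_mono) auto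
    finally show "exp_con P j (u + K *\<^sub>R (v - u)) \<le> (1 - \<theta>) * exp_con P j u"
      by (simp add: algebra_simps)
  qed
qed

text \<open>The gain condition says that the curvature term computed with \<open>M\<close> at most cancels the
  first-order decrease; the actual curvature term is smaller by the factor \<open>\<theta>\<close>, so the
  fraction \<open>1 - \<theta>\<close> of the first-order decrease survives.\<close>

lemma cost_step_decrease:
  obtains \<theta> where "0 \<le> \<theta>" "\<theta> < 1"
    "\<And>u v K. \<lbrakk>u \<in> box_of P; v \<in> box_of P; K \<in> gains P \<kappa> M u v\<rbrakk>
      \<Longrightarrow> cost P (u + K *\<^sub>R (v - u)) \<le> cost P u + (1 - \<theta>) * K * (grad (cost P) u \<bullet> (v - u))"
proof -
  obtain S where S: "box_of P \<subseteq> S" "C2_on S (cost P)"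
    using cost_C2 by blast
  obtain \<theta> where \<theta>: "0 \<le> \<theta>" "\<theta> < 1"
    "\<And>ij x. ij \<in> UNIV \<Longrightarrow> x \<in> box_of P \<Longrightarrow>
      \<bar>partial (snd ij) (partial (fst ij) (cost P)) x\<bar> \<le> \<theta> * M (fst ij) (snd ij)"
  proof (rule strict_bounds_have_slack[where I = UNIV
        and h = "\<lambda>ij. partial (snd ij) (partial (fst ij) (cost P))" and c = "\<lambda>ij. M (fst ij) (snd ij)"])
    show "compact (box_of P)" by (rule compact_box_of)
    show "continuous_on (box_of P) (partial (snd ij) (partial (fst ij) (cost P)))" for ij
      using C2_on_continuous(4)[OF S(2)] S(1) continuous_on_subset by blast
    show "\<bar>partial (snd ij) (partial (fst ij) (cost P)) x\<bar> < M (fst ij) (snd ij)"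
      if "x \<in> box_of P" for ij x
      using M that by (auto simp: abs_less_iff minus_less_iff)
    show "finite (UNIV :: ('n \<times> 'n) set)" by simp
  qed (rule that)
  show thesis
  proof (rule that[OF \<theta>(1,2)])
    fix u v K
    assume u: "u \<in> box_of P" and v: "v \<in> box_of P" and K: "K \<in> gains P \<kappa> M u v"
    let ?s = "\<lambda>c. \<Sum>i\<in>UNIV. \<Sum>j\<in>UNIV. c i j * \<bar>(v $ i - u $ i) * (v $ j - u $ j)\<bar>"
    let ?g = "grad (cost P) u \<bullet> (v - u)"
    have K': "0 \<le> K" "K \<le> 1" "?g + K / 2 * ?s M \<le> 0"
      using K by (auto simp: gains_def)
    have "cost P (u + K *\<^sub>R (v - u)) \<le> cost P u + K * ?g + K\<^sup>2 / 2 * ?s (\<lambda>i j. \<theta> * M i j)"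
      using \<theta>(3)[of "(_, _)"]
      by (intro C2_on_second_order_bound[OF S(2) convex_box_of S(1) u v K'(1,2)]) auto
    also have "?s (\<lambda>i j. \<theta> * M i j) = \<theta> * ?s M"
      by (simp add: sum_distrib_left mult_ac)
    also have "K\<^sup>2 / 2 * (\<theta> * ?s M) = (K * \<theta>) * (K / 2 * ?s M)"
      by (simp add: power2_eq_square)
    also have "\<dots> \<le> (K * \<theta>) * (- ?g)"
      using K' \<theta>(1) by (intro mult_left_mono) auto
    finally show "cost P (u + K *\<^sub>R (v - u)) \<le> cost P u + (1 - \<theta>) * K * ?g"
      by (simp add: algebra_simps)
  qed
qed

lemma step_strictly_feasible:
  assumes u: "u \<in> strictly_feasible P" and v: "v \<in> box_of P" and K: "K \<in> gains P \<kappa> M u v"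
  shows "u + K *\<^sub>R (v - u) \<in> strictly_feasible P"
proof -
  obtain \<theta> where \<theta>: "0 \<le> \<theta>" "\<theta> < 1" "\<And>j u v K. \<lbrakk>j \<in> exp_idx P; u \<in> box_of P; v \<in> box_of P; K \<in> gains P \<kappa> M u v\<rbrakk>
      \<Longrightarrow> exp_con P j (u + K *\<^sub>R (v - u)) \<le> (1 - \<theta>) * exp_con P j u"
    using exp_con_step_contraction by metis
  have uP: "u \<in> box_of P" using u by (simp add: strictly_feasible_def)
  have "exp_con P j (u + K *\<^sub>R (v - u)) < 0" if "j \<in> exp_idx P" for j
  proof -
    have "exp_con P j u < 0" using u that by (simp add: strictly_feasible_def)
    then have "(1 - \<theta>) * exp_con P j u < 0" using \<theta>(2) by (simp add: mult_pos_neg)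
    then show ?thesis using \<theta>(3)[OF that uP v K] by linarith
  qed
  moreover have "num_con P j (u + K *\<^sub>R (v - u)) \<le> 0" if "j \<in> num_idx P" for j
    using K that by (simp add: gains_def)
  moreover have "u + K *\<^sub>R (v - u) \<in> box_of P"
    using K by (intro line_in_convex[OF convex_box_of uP v]) (auto simp: gains_def)
  ultimately show ?thesis by (simp add: strictly_feasible_def)
qed

lemma run_strictly_feasible:
  assumes u0: "u0 \<in> strictly_feasible P" and run: "scheme_run P \<kappa> M u0 prm target u"
  shows "u k \<in> strictly_feasible P"
proof (induction k)
  case 0
  then show ?case using u0 run by (simp add: scheme_run_def)
next
  case (Suc k)
  show ?case
  proof (cases "proj_set P prm (u k) = {}")
    case True
    then have "u (Suc k) = u k" using run by (simp add: scheme_run_def)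
    then show ?thesis using Suc by simp
  next
    case False
    then obtain ubar K where "is_projection P prm (u k) (target (Suc k)) ubar"
      "K \<in> gains P \<kappa> M (u k) ubar" "u (Suc k) = u k + K *\<^sub>R (ubar - u k)"
      using run unfolding scheme_run_def by metis
    moreover from this(1) have "ubar \<in> box_of P"
      unfolding is_projection_def is_arg_min_def using proj_set_subset_box by blast
    ultimately show ?thesis
      using step_strictly_feasible[OF Suc] by simp
  qed
qed

text \<open>Below the level \<open>- \<eta>\<close> the contraction lemma leaves a margin of at least
  \<open>(1 - \<theta>) \<eta>\<close>.  Above that level the constraint enters the projection problem, so the
  first-order change per unit gain is at most \<open>- \<delta>\<close>.  The bounds \<open>\<kappa>\<close> dominate this change, and therefore
  the gain condition gives \<open>K \<delta> \<le> \<eta>\<close>.  With \<open>\<eta> \<le> \<delta>\<^sup>2 / C\<close> the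
  second-order term \<open>C K\<^sup>2\<close> cannot exceed the decrease \<open>K \<delta>\<close>.\<close>

lemma exp_con_keeps_margin:
  assumes prm: "prm \<in> positive_params" and j: "j \<in> exp_idx P"
  obtains \<beta> where "0 < \<beta>"
    "\<And>u v K. \<lbrakk>u \<in> strictly_feasible P; v \<in> proj_set P prm u; K \<in> gains P \<kappa> M u v\<rbrakk>
      \<Longrightarrow> exp_con P j (u + K *\<^sub>R (v - u)) \<le> max (exp_con P j u) (- \<beta>)"
proof -
  obtain ep e dp d dphi where prm_eq: "prm = (ep, e, dp, d, dphi)" by (cases prm)
  define \<delta> where "\<delta> = dp $ j"
  have pos: "0 < ep $ j" "0 < \<delta>" using prm by (auto simp: prm_eq positive_params_def \<delta>_def)
  obtain S where S: "box_of P \<subseteq> S" "C2_on S (exp_con P j)"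
    using exp_con_C2 j by blast
  obtain C where C: "0 < C"
    "\<And>u v K. \<lbrakk>u \<in> box_of P; v \<in> box_of P; 0 \<le> K; K \<le> 1\<rbrakk> \<Longrightarrow>
      exp_con P j (u + K *\<^sub>R (v - u)) \<le> exp_con P j u + C * K"
    "\<And>u v K. \<lbrakk>u \<in> box_of P; v \<in> box_of P; 0 \<le> K; K \<le> 1\<rbrakk> \<Longrightarrow>
      exp_con P j (u + K *\<^sub>R (v - u))
        \<le> exp_con P j u + K * (grad (exp_con P j) u \<bullet> (v - u)) + C * K\<^sup>2"
    using C2_on_uniform_bounds[OF S(2) convex_box_of compact_box_of S(1)] by metis
  obtain \<theta> where \<theta>: "0 \<le> \<theta>" "\<theta> < 1" "\<And>j u v K. \<lbrakk>j \<in> exp_idx P; u \<in> box_of P; v \<in> box_of P; K \<in> gains P \<kappa> M u v\<rbrakk>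
      \<Longrightarrow> exp_con P j (u + K *\<^sub>R (v - u)) \<le> (1 - \<theta>) * exp_con P j u"
    using exp_con_step_contraction by metis
  define \<eta> where "\<eta> = min (ep $ j) (\<delta>\<^sup>2 / C)"
  have \<eta>: "0 < \<eta>" "\<eta> \<le> ep $ j" "\<eta> \<le> \<delta>\<^sup>2 / C" using pos C(1) by (auto simp: \<eta>_def)
  show thesis
  proof (rule that[of "(1 - \<theta>) * \<eta>"])
    show "0 < (1 - \<theta>) * \<eta>" using \<eta> \<theta> by simp
    fix u v K
    assume u: "u \<in> strictly_feasible P" and v: "v \<in> proj_set P prm u" and K: "K \<in> gains P \<kappa> M u v"
    let ?g = "grad (exp_con P j) u \<bullet> (v - u)"
    have box: "u \<in> box_of P" "v \<in> box_of P"
      using u proj_set_subset_box[OF v] by (auto simp: strictly_feasible_def)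
    have K01: "0 \<le> K" "K \<le> 1" using K by (auto simp: gains_def)
    show "exp_con P j (u + K *\<^sub>R (v - u)) \<le> max (exp_con P j u) (- ((1 - \<theta>) * \<eta>))"
    proof (cases "exp_con P j u \<le> - \<eta>")
      case True
      have "exp_con P j (u + K *\<^sub>R (v - u)) \<le> (1 - \<theta>) * exp_con P j u"
        by (rule \<theta>(3)[OF j box K])
      also have "\<dots> \<le> (1 - \<theta>) * (- \<eta>)" using True \<theta>(2) by (intro mult_left_mono) auto
      finally show ?thesis by simp
    next
      case False
      then have g: "?g \<le> - \<delta>" using v j \<eta>(2) by (auto simp: prm_eq \<delta>_def)
      have "- ?g \<le> (\<Sum>i\<in>UNIV. \<kappa> j i * \<bar>v $ i - u $ i\<bar>)"
        unfolding inner_grad sum_negf[symmetric]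
      proof (rule sum_mono)
        fix i
        have "- (partial i (exp_con P j) u * (v - u) $ i) \<le> \<bar>partial i (exp_con P j) u\<bar> * \<bar>(v - u) $ i\<bar>"
          by (metis abs_ge_minus_self abs_mult)
        also have "\<dots> \<le> \<kappa> j i * \<bar>v $ i - u $ i\<bar>"
          unfolding vector_minus_component
          using kappa j box(1) by (intro mult_right_mono) (auto simp: abs_le_iff minus_le_iff less_imp_le)
        finally show "- (partial i (exp_con P j) u * (v - u) $ i) \<le> \<kappa> j i * \<bar>v $ i - u $ i\<bar>" .
      qed
      with g have "\<delta> \<le> (\<Sum>i\<in>UNIV. \<kappa> j i * \<bar>v $ i - u $ i\<bar>)" by linarith
      then have "K * \<delta> \<le> K * (\<Sum>i\<in>UNIV. \<kappa> j i * \<bar>v $ i - u $ i\<bar>)"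
        using K01(1) by (rule mult_left_mono)
      also have "\<dots> \<le> - exp_con P j u" using K j by (auto simp: gains_def)
      also have "\<dots> \<le> \<delta>\<^sup>2 / C" using False \<eta>(3) by linarith
      finally have "C * K \<le> \<delta>" using C(1) pos(2) by (simp add: field_simps power2_eq_square)
      have "exp_con P j (u + K *\<^sub>R (v - u)) \<le> exp_con P j u + K * ?g + C * K\<^sup>2"
        by (rule C(3)[OF box K01])
      also have "\<dots> = exp_con P j u + K * (?g + C * K)"
        by (simp add: algebra_simps power2_eq_square)
      also have "\<dots> \<le> exp_con P j u"
        using g \<open>C * K \<le> \<delta>\<close> K01(1) by (simp add: mult_nonneg_nonpos)
      finally show ?thesis by simp
    qed
  qed
qed

text \<open>Each gain condition holds for all small enough \<open>K\<close>, with a threshold that does not depend on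
  the point: the margin \<open>\<beta>\<close> serves the experimental constraints, the projection forces the
  decrease \<open>\<delta>\<close> on the cost and on every nearly active numerical constraint, and the
  remaining numerical constraints lie below \<open>- \<epsilon>\<close>.\<close>

lemma uniform_gain:
  assumes prm: "prm \<in> positive_params" and \<beta>: "0 < \<beta>"
  obtains K where "0 < K"
    "\<And>u v. \<lbrakk>u \<in> strictly_feasible P; \<And>j. j \<in> exp_idx P \<Longrightarrow> exp_con P j u \<le> - \<beta>;
        v \<in> proj_set P prm u\<rbrakk> \<Longrightarrow> K \<in> gains P \<kappa> M u v"
proof -
  obtain ep e dp d dphi where prm_eq: "prm = (ep, e, dp, d, dphi)" by (cases prm)
  obtain D where D: "\<And>u v i. \<lbrakk>u \<in> box_of P; v \<in> box_of P\<rbrakk> \<Longrightarrow> \<bar>v $ i - u $ i\<bar> \<le> D"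
    using compact_component_distance[OF compact_box_of] by blast
  have ev_exp: "\<forall>\<^sub>F K in at_right 0. \<forall>j\<in>exp_idx P. \<forall>u\<in>box_of P. \<forall>v\<in>box_of P.
      exp_con P j u \<le> - \<beta> \<longrightarrow>
      exp_con P j u + K * (\<Sum>i\<in>UNIV. \<kappa> j i * \<bar>v $ i - u $ i\<bar>) \<le> 0"
  proof (rule eventually_ball_finite[OF finite], rule ballI)
    fix j assume "j \<in> exp_idx P"
    define A where "A = (\<Sum>i\<in>UNIV. \<bar>\<kappa> j i\<bar> * D)"
    have A: "(\<Sum>i\<in>UNIV. \<kappa> j i * \<bar>v $ i - u $ i\<bar>) \<le> A" if "u \<in> box_of P" "v \<in> box_of P" for u v
      unfolding A_def using D[OF that] by (intro sum_mono mult_mono) auto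
    show "\<forall>\<^sub>F K in at_right 0. \<forall>u\<in>box_of P. \<forall>v\<in>box_of P. exp_con P j u \<le> - \<beta> \<longrightarrow>
        exp_con P j u + K * (\<Sum>i\<in>UNIV. \<kappa> j i * \<bar>v $ i - u $ i\<bar>) \<le> 0"
      using eventually_small_multiple[OF \<beta>, of A] eventually_at_right_less
    proof eventually_elim
      case (elim K)
      show ?case
      proof safe
        fix u v assume "u \<in> box_of P" "v \<in> box_of P" and m: "exp_con P j u \<le> - \<beta>"
        from mult_left_mono[OF A[OF this(1,2)], of K]
        show "exp_con P j u + K * (\<Sum>i\<in>UNIV. \<kappa> j i * \<bar>v $ i - u $ i\<bar>) \<le> 0"
          using elim m by linarith
      qed
    qed
  qed
  have ev_num: "\<forall>\<^sub>F K in at_right 0. \<forall>j\<in>num_idx P. \<forall>u\<in>strictly_feasible P.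
      \<forall>v\<in>proj_set P prm u. num_con P j (u + K *\<^sub>R (v - u)) \<le> 0"
  proof (rule eventually_ball_finite[OF finite], rule ballI)
    fix j assume j: "j \<in> num_idx P"
    have pos: "0 < e $ j" "0 < d $ j" using prm by (auto simp: prm_eq positive_params_def)
    obtain S where S: "box_of P \<subseteq> S" "C2_on S (num_con P j)"
      using num_con_C2 j by blast
    obtain C where C: "0 < C"
      "\<And>u v K. \<lbrakk>u \<in> box_of P; v \<in> box_of P; 0 \<le> K; K \<le> 1\<rbrakk> \<Longrightarrow>
        num_con P j (u + K *\<^sub>R (v - u)) \<le> num_con P j u + C * K"
      "\<And>u v K. \<lbrakk>u \<in> box_of P; v \<in> box_of P; 0 \<le> K; K \<le> 1\<rbrakk> \<Longrightarrow>
        num_con P j (u + K *\<^sub>R (v - u))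
          \<le> num_con P j u + K * (grad (num_con P j) u \<bullet> (v - u)) + C * K\<^sup>2"
      using C2_on_uniform_bounds[OF S(2) convex_box_of compact_box_of S(1)] by metis
    show "\<forall>\<^sub>F K in at_right 0. \<forall>u\<in>strictly_feasible P. \<forall>v\<in>proj_set P prm u.
        num_con P j (u + K *\<^sub>R (v - u)) \<le> 0"
      using eventually_small_multiple[OF pos(1), of C] eventually_small_multiple[OF pos(2), of C]
        eventually_small_multiple[of 1 1, OF zero_less_one] eventually_at_right_less
    proof eventually_elim
      case (elim K)
      show ?case
      proof safe
        fix u v assume u: "u \<in> strictly_feasible P" and v: "v \<in> proj_set P prm u"
        have box: "u \<in> box_of P" "v \<in> box_of P" and le: "num_con P j u \<le> 0"
          using u j proj_set_subset_box[OF v] by (auto simp: strictly_feasible_def)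
        have K01: "0 \<le> K" "K \<le> 1" using elim by auto
        show "num_con P j (u + K *\<^sub>R (v - u)) \<le> 0"
        proof (cases "num_con P j u \<ge> - (e $ j)")
          case True
          let ?g = "grad (num_con P j) u \<bullet> (v - u)"
          have g: "?g \<le> - (d $ j)" using True v j by (auto simp: prm_eq)
          have "K * ?g + C * K\<^sup>2 = K * (?g + K * C)"
            by (simp add: algebra_simps power2_eq_square)
          also have "\<dots> \<le> 0" using g elim(2) K01(1) by (simp add: mult_nonneg_nonpos)
          finally show ?thesis using C(3)[OF box K01] le by linarith
        next
          case False
          then show ?thesis using C(2)[OF box K01] elim(1) by (simp add: mult.commute)
        qed
      qed
    qed
  qed
  have ev_cost: "\<forall>\<^sub>F K in at_right 0. \<forall>u\<in>box_of P. \<forall>v\<in>proj_set P prm u.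
      grad (cost P) u \<bullet> (v - u) + K / 2 *
        (\<Sum>i1\<in>UNIV. \<Sum>i2\<in>UNIV. M i1 i2 * \<bar>(v $ i1 - u $ i1) * (v $ i2 - u $ i2)\<bar>) \<le> 0"
  proof -
    have pos: "0 < dphi" using prm by (auto simp: prm_eq positive_params_def)
    define A where "A = (\<Sum>i1\<in>UNIV. \<Sum>i2\<in>UNIV. \<bar>M i1 i2\<bar> * (D * D))"
    have A: "(\<Sum>i1\<in>UNIV. \<Sum>i2\<in>UNIV. M i1 i2 * \<bar>(v $ i1 - u $ i1) * (v $ i2 - u $ i2)\<bar>) \<le> A"
      if "u \<in> box_of P" "v \<in> box_of P" for u v
    proof -
      have "0 \<le> D" using D[OF that(1) that(1)] by simp
      then show ?thesis
        unfolding A_def abs_mult using D[OF that] by (intro sum_mono mult_mono) auto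
    qed
    show ?thesis
      using eventually_small_multiple[OF pos, of "A / 2"] eventually_at_right_less
    proof eventually_elim
      case (elim K)
      show ?case
      proof safe
        fix u v assume u: "u \<in> box_of P" and v: "v \<in> proj_set P prm u"
        have "grad (cost P) u \<bullet> (v - u) \<le> - dphi" using v by (simp add: prm_eq)
        moreover from mult_left_mono[OF A[OF u proj_set_subset_box[OF v]], of "K / 2"]
        have "K / 2 * (\<Sum>i1\<in>UNIV. \<Sum>i2\<in>UNIV. M i1 i2 * \<bar>(v $ i1 - u $ i1) * (v $ i2 - u $ i2)\<bar>)
          \<le> K * (A / 2)" using elim by simp
        ultimately show "grad (cost P) u \<bullet> (v - u) + K / 2 *
          (\<Sum>i1\<in>UNIV. \<Sum>i2\<in>UNIV. M i1 i2 * \<bar>(v $ i1 - u $ i1) * (v $ i2 - u $ i2)\<bar>) \<le> 0"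
          using elim(1) by linarith
      qed
    qed
  qed
  have "\<forall>\<^sub>F K in at_right 0. 0 < K \<and> (\<forall>u v. u \<in> strictly_feasible P \<longrightarrow>
      (\<forall>j\<in>exp_idx P. exp_con P j u \<le> - \<beta>) \<longrightarrow> v \<in> proj_set P prm u \<longrightarrow> K \<in> gains P \<kappa> M u v)"
    using ev_exp ev_num ev_cost eventually_small_multiple[of 1 1, OF zero_less_one] eventually_at_right_less
  proof eventually_elim
    case (elim K)
    show ?case
    proof (intro conjI allI impI)
      fix u v
      assume u: "u \<in> strictly_feasible P" and m: "\<forall>j\<in>exp_idx P. exp_con P j u \<le> - \<beta>"
        and v: "v \<in> proj_set P prm u"
      have box: "u \<in> box_of P" "v \<in> box_of P"
        using u proj_set_subset_box[OF v] by (auto simp: strictly_feasible_def)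
      have "\<forall>j\<in>exp_idx P. exp_con P j u + K * (\<Sum>i\<in>UNIV. \<kappa> j i * \<bar>v $ i - u $ i\<bar>) \<le> 0"
        using elim(1) box m by blast
      moreover have "\<forall>j\<in>num_idx P. num_con P j (u + K *\<^sub>R (v - u)) \<le> 0"
        using elim(2) u v by blast
      ultimately show "K \<in> gains P \<kappa> M u v"
        using elim(3-5) box(1) v by (simp add: gains_def)
    qed (rule elim(5))
  qed
  from eventually_happens'[OF trivial_limit_at_right_real this]
  obtain K where "0 < K \<and> (\<forall>u v. u \<in> strictly_feasible P \<longrightarrow>
      (\<forall>j\<in>exp_idx P. exp_con P j u \<le> - \<beta>) \<longrightarrow> v \<in> proj_set P prm u \<longrightarrow> K \<in> gains P \<kappa> M u v)"
    by blast
  with that show thesis by metis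
qed

lemma scheme_becomes_infeasible:
  assumes prm: "prm \<in> positive_params" and u0: "u0 \<in> strictly_feasible P"
    and run: "scheme_run P \<kappa> M u0 prm target u"
  shows "\<exists>k. proj_set P prm (u k) = {}"
proof (rule ccontr)
  assume feas: "\<not> ?thesis"
  obtain ep e dp d dphi where prm_eq: "prm = (ep, e, dp, d, dphi)" by (cases prm)
  have dphi: "0 < dphi" using prm by (auto simp: prm_eq positive_params_def)
  have "\<forall>k. \<exists>v K. v \<in> proj_set P prm (u k) \<and> K \<in> gains P \<kappa> M (u k) v \<and>
      (\<forall>K'\<in>gains P \<kappa> M (u k) v. K' \<le> K) \<and> u (Suc k) = u k + K *\<^sub>R (v - u k)"
    using run feas unfolding scheme_run_def is_projection_def is_arg_min_def by metis
  then obtain v K where vK: "\<And>k. v k \<in> proj_set P prm (u k)" "\<And>k. K k \<in> gains P \<kappa> M (u k) (v k)"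
    "\<And>k K'. K' \<in> gains P \<kappa> M (u k) (v k) \<Longrightarrow> K' \<le> K k"
    "\<And>k. u (Suc k) = u k + K k *\<^sub>R (v k - u k)"
    by metis
  have sf: "u k \<in> strictly_feasible P" for k
    by (rule run_strictly_feasible[OF u0 run])
  then have ubox: "u k \<in> box_of P" for k by (simp add: strictly_feasible_def)
  have "\<exists>\<beta>>0. \<forall>k. exp_con P j (u k) \<le> - \<beta>" if j: "j \<in> exp_idx P" for j
  proof -
    obtain \<beta> where \<beta>: "0 < \<beta>" "\<And>u v K. \<lbrakk>u \<in> strictly_feasible P; v \<in> proj_set P prm u; K \<in> gains P \<kappa> M u v\<rbrakk>
      \<Longrightarrow> exp_con P j (u + K *\<^sub>R (v - u)) \<le> max (exp_con P j u) (- \<beta>)"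
      using exp_con_keeps_margin[OF prm j] by metis
    have "exp_con P j (u k) \<le> max (exp_con P j (u 0)) (- \<beta>)" for k
    proof (induction k)
      case (Suc k)
      then show ?case using \<beta>(2)[OF sf vK(1,2), of k] by (simp add: vK(4))
    qed simp
    moreover have "exp_con P j (u 0) < 0" using sf[of 0] j by (simp add: strictly_feasible_def)
    ultimately show ?thesis
      using \<beta>(1) by (intro exI[of _ "- max (exp_con P j (u 0)) (- \<beta>)"]) simp
  qed
  then obtain b where b: "\<And>j. j \<in> exp_idx P \<Longrightarrow> 0 < b j"
    "\<And>j k. j \<in> exp_idx P \<Longrightarrow> exp_con P j (u k) \<le> - b j"
    by metis
  define \<beta> where "\<beta> = Min (insert 1 (b ` exp_idx P))"
  have \<beta>: "0 < \<beta>" using b(1) by (auto simp: \<beta>_def)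
  have margin: "exp_con P j (u k) \<le> - \<beta>" if "j \<in> exp_idx P" for j k
  proof -
    have "\<beta> \<le> b j" using that by (auto simp: \<beta>_def)
    then show ?thesis using b(2)[OF that, of k] by linarith
  qed
  obtain K0 where K0: "0 < K0" "\<And>u v. \<lbrakk>u \<in> strictly_feasible P;
      \<And>j. j \<in> exp_idx P \<Longrightarrow> exp_con P j u \<le> - \<beta>; v \<in> proj_set P prm u\<rbrakk> \<Longrightarrow> K0 \<in> gains P \<kappa> M u v"
    using uniform_gain[OF prm \<beta>] by metis
  have K0_le: "K0 \<le> K k" for k
    by (rule vK(3), rule K0(2)[OF sf margin vK(1)])
  obtain \<theta> where \<theta>: "0 \<le> \<theta>" "\<theta> < 1" "\<And>u v K. \<lbrakk>u \<in> box_of P; v \<in> box_of P; K \<in> gains P \<kappa> M u v\<rbrakk>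
      \<Longrightarrow> cost P (u + K *\<^sub>R (v - u)) \<le> cost P u + (1 - \<theta>) * K * (grad (cost P) u \<bullet> (v - u))"
    using cost_step_decrease by metis
  define c where "c = (1 - \<theta>) * K0 * dphi"
  have c: "0 < c" using \<theta>(2) K0(1) dphi by (simp add: c_def)
  have step: "cost P (u (Suc k)) \<le> cost P (u k) - c" for k
  proof -
    have "dphi \<le> - (grad (cost P) (u k) \<bullet> (v k - u k))"
      using vK(1)[of k] by (simp add: prm_eq)
    then have "c \<le> (1 - \<theta>) * K k * - (grad (cost P) (u k) \<bullet> (v k - u k))"
      unfolding c_def using K0_le[of k] K0(1) \<theta>(2) dphi by (intro mult_mono) auto
    then show ?thesis
      using \<theta>(3)[OF ubox proj_set_subset_box[OF vK(1)] vK(2), of k] by (simp add: vK(4))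
  qed
  have descent: "cost P (u k) \<le> cost P (u 0) - k * c" for k
  proof (induction k)
    case (Suc k)
    then show ?case using step[of k] by (simp add: algebra_simps)
  qed simp
  obtain S where S: "box_of P \<subseteq> S" "C2_on S (cost P)"
    using cost_C2 by blast
  obtain B where B: "\<And>x. x \<in> box_of P \<Longrightarrow> \<bar>cost P x\<bar> \<le> B"
    using continuous_compact_abs_bound[OF compact_box_of continuous_on_subset[OF C2_on_continuous(1)[OF S(2)] S(1)]]
    by blast
  obtain k :: nat where "2 * B / c < k" using reals_Archimedean2 by blast
  then have "2 * B < k * c" using c by (simp add: field_simps)
  moreover have "cost P (u 0) \<le> B" "- B \<le> cost P (u k)"
    using B[OF ubox[of 0]] B[OF ubox[of k]] by auto
  ultimately show False using descent[of k] by linarith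
qed

end

section \<open>Fritz John multipliers at a point without strict descent direction\<close>

lemma grad_lagrangian_scaleR:
  "grad_lagrangian P u (c *\<^sub>R m) = c *\<^sub>R grad_lagrangian P u m"
  by (cases m) (simp add: algebra_simps scaleR_sum_right)

lemma FJ_residual_scaleR: "FJ_residual P u (c *\<^sub>R m) = c\<^sup>2 * FJ_residual P u m"
proof -
  obtain mphi mp mg zL zU where m: "m = (mphi, mp, mg, zL, zU)" by (cases m)
  have "grad_lagrangian P u (c *\<^sub>R m) \<bullet> grad_lagrangian P u (c *\<^sub>R m)
      = c\<^sup>2 * (grad_lagrangian P u m \<bullet> grad_lagrangian P u m)"
    unfolding grad_lagrangian_scaleR by (simp add: power2_eq_square)
  then show ?thesis
    unfolding m by (simp add: power_mult_distrib distrib_left sum_distrib_left mult_ac sum.distrib)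
qed

text \<open>The residual is homogeneous of degree two, so a vanishing residual survives normalisation.\<close>

lemma unit_multiplier_of_nonzero:
  fixes P :: "('n::finite, 'p::finite, 'g::finite) opt_problem"
  assumes N: "is_norm N" and nz: "(mphi, mp, mg, zL, zU) \<noteq> 0"
    and nonneg: "0 \<le> mphi" "\<And>j. 0 \<le> mp $ j" "\<And>j. 0 \<le> mg $ j" "\<And>i. 0 \<le> zL $ i" "\<And>i. 0 \<le> zU $ i"
    and supp: "\<And>j. j \<notin> exp_idx P \<Longrightarrow> mp $ j = 0" "\<And>j. j \<notin> num_idx P \<Longrightarrow> mg $ j = 0"
    and res: "FJ_residual P u (mphi, mp, mg, zL, zU) = 0"
  shows "\<exists>m\<in>unit_multipliers P N. FJ_residual P u m = 0"
proof
  let ?m = "(mphi, mp, mg, zL, zU)"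
  have pos: "0 < N ?m" by (rule is_norm_pos[OF N nz])
  have one: "N ((1 / N ?m) *\<^sub>R ?m) = 1"
    unfolding is_normD(3)[OF N] using pos by simp
  show "(1 / N ?m) *\<^sub>R ?m \<in> unit_multipliers P N"
    using pos nonneg supp one by (simp add: unit_multipliers_def)
  show "FJ_residual P u ((1 / N ?m) *\<^sub>R ?m) = 0"
    unfolding FJ_residual_scaleR res by simp
qed

text \<open>At a minimiser of a linear form over the box, a component of \<open>w\<close> can only be positive at the
  lower and only be negative at the upper bound of its coordinate, since otherwise moving that
  coordinate to the bound would decrease the form.  The positive and negative parts of \<open>w\<close> thus
  serve as multipliers of the bounds.\<close>

lemma complementary_bound_multipliers:
  assumes v: "v \<in> box_of P" and w: "\<And>u. u \<in> box_of P \<Longrightarrow> 0 \<le> w \<bullet> (u - v)"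
  shows "max (w $ i) 0 * (lower P $ i - v $ i) = 0" "max (- w $ i) 0 * (v $ i - upper P $ i) = 0"
proof -
  have b: "lower P $ i \<le> v $ i" "v $ i \<le> upper P $ i" using v by (auto simp: box_of_def)
  have move: "0 \<le> w $ i * (c - v $ i)" if c: "lower P $ i \<le> c" "c \<le> upper P $ i" for c
  proof -
    have "v + axis i (c - v $ i) \<in> box_of P"
      using v c by (auto simp: box_of_def axis_def)
    from w[OF this] show ?thesis by (simp add: inner_axis)
  qed
  have "w $ i \<le> 0 \<or> lower P $ i = v $ i"
    using move[of "lower P $ i"] b by (auto simp: zero_le_mult_iff)
  then show "max (w $ i) 0 * (lower P $ i - v $ i) = 0" by auto
  have "0 \<le> w $ i \<or> upper P $ i = v $ i"
    using move[of "upper P $ i"] b by (auto simp: zero_le_mult_iff)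
  then show "max (- w $ i) 0 * (v $ i - upper P $ i) = 0" by auto
qed

text \<open>The alternative applied on the box to the linearised cost and active constraints yields weights
  whose combined gradient \<open>w\<close> makes \<open>v\<close> a minimiser of \<open>w \<bullet> u\<close> over the box;
  the bound multipliers then cancel \<open>w\<close>.\<close>

lemma fritz_john_multipliers:
  fixes P :: "('n::finite, 'p::finite, 'g::finite) opt_problem"
  assumes N: "is_norm N" and v: "v \<in> box_of P"
    and stuck: "\<not> (\<exists>u\<in>box_of P. grad (cost P) v \<bullet> (u - v) < 0 \<and>
      (\<forall>j\<in>exp_idx P. exp_con P j v = 0 \<longrightarrow> grad (exp_con P j) v \<bullet> (u - v) < 0) \<and>
      (\<forall>j\<in>num_idx P. num_con P j v = 0 \<longrightarrow> grad (num_con P j) v \<bullet> (u - v) < 0))"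
  shows "\<exists>m\<in>unit_multipliers P N. FJ_residual P v m = 0"
proof -
  \<comment> \<open>The alternative needs one index type: \<open>None\<close> stands for the cost.\<close>
  define A :: "('p + 'g) option \<Rightarrow> real ^ 'n" where "A x = (case x of None \<Rightarrow> grad (cost P) v
    | Some (Inl j) \<Rightarrow> grad (exp_con P j) v | Some (Inr j) \<Rightarrow> grad (num_con P j) v)" for x
  define J :: "('p + 'g) option set" where "J = {x. case x of None \<Rightarrow> True
    | Some (Inl j) \<Rightarrow> j \<in> exp_idx P \<and> exp_con P j v = 0
    | Some (Inr j) \<Rightarrow> j \<in> num_idx P \<and> num_con P j v = 0}"
  have J_simps [simp]: "None \<in> J" "Some (Inl jp) \<in> J \<longleftrightarrow> jp \<in> exp_idx P \<and> exp_con P jp v = 0"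
    "Some (Inr jg) \<in> J \<longleftrightarrow> jg \<in> num_idx P \<and> num_con P jg v = 0" for jp jg
    by (auto simp: J_def)
  have A_simps [simp]: "A None = grad (cost P) v" "A (Some (Inl jp)) = grad (exp_con P jp) v"
    "A (Some (Inr jg)) = grad (num_con P jg) v" for jp jg
    by (auto simp: A_def)
  obtain l where l: "\<And>x. 0 \<le> l x" "\<And>x. x \<notin> J \<Longrightarrow> l x = 0" "\<exists>x\<in>J. l x \<noteq> 0"
    "\<And>u. u \<in> box_of P \<Longrightarrow> 0 \<le> (\<Sum>x\<in>J. l x * (A x \<bullet> (u - v)))"
  proof (rule convex_strict_alternative[where C = "box_of P" and J = J and h = "\<lambda>x u. A x \<bullet> (u - v)"])
    show "box_of P \<noteq> {}" using v by blast
    show "convex_on (box_of P) (\<lambda>u. A x \<bullet> (u - v))" for x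
      using convex_box_of by (intro convex_onI) (simp_all add: algebra_simps inner_simps)
    show "\<not> (\<exists>u\<in>box_of P. \<forall>x\<in>J. A x \<bullet> (u - v) < 0)"
    proof
      assume "\<exists>u\<in>box_of P. \<forall>x\<in>J. A x \<bullet> (u - v) < 0"
      then obtain u where "u \<in> box_of P" and u: "\<And>x. x \<in> J \<Longrightarrow> A x \<bullet> (u - v) < 0" by blast
      moreover have "grad (cost P) v \<bullet> (u - v) < 0" using u[of None] by simp
      moreover have "grad (exp_con P j) v \<bullet> (u - v) < 0" if "j \<in> exp_idx P" "exp_con P j v = 0" for j
        using u[of "Some (Inl j)"] that by simp
      moreover have "grad (num_con P j) v \<bullet> (u - v) < 0" if "j \<in> num_idx P" "num_con P j v = 0" for j
        using u[of "Some (Inr j)"] that by simp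
      ultimately show False using stuck by blast
    qed
  qed (rule that)
  define w where "w = (\<Sum>x\<in>J. l x *\<^sub>R A x)"
  have w_nonneg: "0 \<le> w \<bullet> (u - v)" if "u \<in> box_of P" for u
    using l(4)[OF that] by (simp add: w_def inner_sum_left)
  define mp :: "real ^ 'p" where "mp = (\<chi> j. l (Some (Inl j)))"
  define mg :: "real ^ 'g" where "mg = (\<chi> j. l (Some (Inr j)))"
  define zL :: "real ^ 'n" where "zL = (\<chi> i. max (w $ i) 0)"
  define zU :: "real ^ 'n" where "zU = (\<chi> i. max (- w $ i) 0)"
  have w_eq: "w = l None *\<^sub>R grad (cost P) v + (\<Sum>j\<in>exp_idx P. (mp $ j) *\<^sub>R grad (exp_con P j) v)
       + (\<Sum>j\<in>num_idx P. (mg $ j) *\<^sub>R grad (num_con P j) v)"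
  proof -
    have "w = (\<Sum>x\<in>UNIV. l x *\<^sub>R A x)"
      unfolding w_def by (rule sum.mono_neutral_left) (auto simp: l(2))
    also have "\<dots> = l None *\<^sub>R A None + (\<Sum>x\<in>UNIV. l (Some x) *\<^sub>R A (Some x))"
      by (simp add: UNIV_option_conv sum.reindex)
    also have "(\<Sum>x\<in>UNIV. l (Some x) *\<^sub>R A (Some x)) =
        (\<Sum>j\<in>UNIV. (mp $ j) *\<^sub>R grad (exp_con P j) v) + (\<Sum>j\<in>UNIV. (mg $ j) *\<^sub>R grad (num_con P j) v)"
      unfolding UNIV_Plus_UNIV[symmetric] by (subst sum.Plus) (auto simp: mp_def mg_def)
    also have "(\<Sum>j\<in>UNIV. (mp $ j) *\<^sub>R grad (exp_con P j) v)
        = (\<Sum>j\<in>exp_idx P. (mp $ j) *\<^sub>R grad (exp_con P j) v)"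
      by (rule sum.mono_neutral_right) (auto simp: mp_def l(2))
    also have "(\<Sum>j\<in>UNIV. (mg $ j) *\<^sub>R grad (num_con P j) v)
        = (\<Sum>j\<in>num_idx P. (mg $ j) *\<^sub>R grad (num_con P j) v)"
      by (rule sum.mono_neutral_right) (auto simp: mg_def l(2))
    finally show ?thesis by (simp add: add.assoc)
  qed
  show ?thesis
  proof (rule unit_multiplier_of_nonzero[OF N])
    obtain x where x: "l x \<noteq> 0" using l(3) by blast
    show "(l None, mp, mg, zL, zU) \<noteq> 0"
    proof
      assume "(l None, mp, mg, zL, zU) = 0"
      then have "l None = 0" "mp = 0" "mg = 0" by (auto simp: zero_prod_def)
      then have "l None = 0" "l (Some (Inl jp)) = 0" "l (Some (Inr jg)) = 0" for jp jg
        by (auto simp: mp_def mg_def vec_eq_iff)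
      with x show False by (metis option.exhaust sum.exhaust)
    qed
    have complementary: "max (w $ i) 0 * (lower P $ i - v $ i) = 0"
      "max (- w $ i) 0 * (v $ i - upper P $ i) = 0" for i
      by (rule complementary_bound_multipliers[OF v], erule w_nonneg)+
    have "w - zL + zU = 0" by (auto simp: vec_eq_iff zL_def zU_def)
    then have "grad_lagrangian P v (l None, mp, mg, zL, zU) = 0" by (simp add: w_eq)
    moreover have "(\<Sum>j\<in>exp_idx P. (mp $ j * exp_con P j v)\<^sup>2) = 0"
      using l(2)[of "Some (Inl _)"] by (intro sum.neutral) (auto simp: mp_def)
    moreover have "(\<Sum>j\<in>num_idx P. (mg $ j * num_con P j v)\<^sup>2) = 0"
      using l(2)[of "Some (Inr _)"] by (intro sum.neutral) (auto simp: mg_def)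
    moreover have "(\<Sum>i\<in>UNIV. (zL $ i * (lower P $ i - v $ i))\<^sup>2
        + (zU $ i * (v $ i - upper P $ i))\<^sup>2) = 0"
      by (simp only: zL_def zU_def vec_lambda_beta complementary) simp
    ultimately show "FJ_residual P v (l None, mp, mg, zL, zU) = 0"
      unfolding FJ_residual.simps by simp
  qed (auto simp: l(1,2) mp_def mg_def zL_def zU_def)
qed

section \<open>Vanishing parameters\<close>

lemma C2_tendsto:
  assumes "\<exists>S. X \<subseteq> S \<and> C2_on S f" and v: "\<And>n. v n \<in> X" "v \<longlonglongrightarrow> l" "l \<in> X"
  shows "(\<lambda>n. f (v n)) \<longlonglongrightarrow> f l" "(\<lambda>n. grad f (v n)) \<longlonglongrightarrow> grad f l"
proof -
  obtain S where S: "X \<subseteq> S" "C2_on S f" using assms(1) by blast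
  have vS: "l \<in> S" "\<forall>\<^sub>F n in sequentially. v n \<in> S"
    using S(1) v by (auto intro!: always_eventually)
  show "(\<lambda>n. f (v n)) \<longlonglongrightarrow> f l" "(\<lambda>n. grad f (v n)) \<longlonglongrightarrow> grad f l"
    using C2_on_continuous(1,2)[OF S(2)] continuous_on_tendsto_compose[OF _ v(2) vS] by blast+
qed

context filtered_scheme
begin

text \<open>A point \<open>u\<close> that strictly decreases the linearised cost and active constraints at \<open>l\<close>
  decreases the linearisations at \<open>v n\<close> by a fixed amount for large \<open>n\<close>, which eventually
  exceeds the required \<open>\<delta>\<close>.  A constraint that is inactive at \<open>l\<close> eventually drops out
  because \<open>\<epsilon>\<close> falls below its distance to zero.  So \<open>u\<close> would eventually solve the
  projection problem.\<close>

lemma infeasible_limit_is_stuck: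
  assumes X: "\<And>n. X n \<in> positive_params" "X \<longlonglongrightarrow> 0"
    and v: "\<And>n. v n \<in> strictly_feasible P" "v \<longlonglongrightarrow> l"
    and infeasible: "\<And>n. proj_set P (X n) (v n) = {}"
  shows "\<not> (\<exists>u\<in>box_of P. grad (cost P) l \<bullet> (u - l) < 0 \<and>
      (\<forall>j\<in>exp_idx P. exp_con P j l = 0 \<longrightarrow> grad (exp_con P j) l \<bullet> (u - l) < 0) \<and>
      (\<forall>j\<in>num_idx P. num_con P j l = 0 \<longrightarrow> grad (num_con P j) l \<bullet> (u - l) < 0))"
proof
  assume "\<exists>u\<in>box_of P. grad (cost P) l \<bullet> (u - l) < 0 \<and>
      (\<forall>j\<in>exp_idx P. exp_con P j l = 0 \<longrightarrow> grad (exp_con P j) l \<bullet> (u - l) < 0) \<and>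
      (\<forall>j\<in>num_idx P. num_con P j l = 0 \<longrightarrow> grad (num_con P j) l \<bullet> (u - l) < 0)"
  then obtain u where u: "u \<in> box_of P" "grad (cost P) l \<bullet> (u - l) < 0"
    "\<And>j. j \<in> exp_idx P \<Longrightarrow> exp_con P j l = 0 \<Longrightarrow> grad (exp_con P j) l \<bullet> (u - l) < 0"
    "\<And>j. j \<in> num_idx P \<Longrightarrow> num_con P j l = 0 \<Longrightarrow> grad (num_con P j) l \<bullet> (u - l) < 0"
    by blast
  define ep e dp d dphi where "ep n = fst (X n)" and "e n = fst (snd (X n))"
    and "dp n = fst (snd (snd (X n)))" and "d n = fst (snd (snd (snd (X n))))"
    and "dphi n = snd (snd (snd (snd (X n))))" for n
  have X_eq: "X n = (ep n, e n, dp n, d n, dphi n)" for n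
    by (simp add: ep_def e_def dp_def d_def dphi_def)
  have lims: "ep \<longlonglongrightarrow> 0" "e \<longlonglongrightarrow> 0" "dp \<longlonglongrightarrow> 0" "d \<longlonglongrightarrow> 0" "dphi \<longlonglongrightarrow> 0"
    unfolding ep_def e_def dp_def d_def dphi_def
    using tendsto_fst[OF X(2)] tendsto_fst[OF tendsto_snd[OF X(2)]]
      tendsto_fst[OF tendsto_snd[OF tendsto_snd[OF X(2)]]]
      tendsto_fst[OF tendsto_snd[OF tendsto_snd[OF tendsto_snd[OF X(2)]]]]
      tendsto_snd[OF tendsto_snd[OF tendsto_snd[OF tendsto_snd[OF X(2)]]]]
    by simp_all
  have vbox: "v n \<in> box_of P" for n using v(1)[of n] by (simp add: strictly_feasible_def)
  have lbox: "l \<in> box_of P"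
    using closed_sequentially[OF compact_imp_closed[OF compact_box_of] vbox v(2)] .
  note tends = C2_tendsto[OF _ vbox v(2) lbox]
  have slope: "\<forall>\<^sub>F n in sequentially. grad f (v n) \<bullet> (u - v n) \<le> - t n"
    if f: "\<exists>S. box_of P \<subseteq> S \<and> C2_on S f" "grad f l \<bullet> (u - l) < 0" and t: "t \<longlonglongrightarrow> 0" for f t
  proof -
    have "(\<lambda>n. grad f (v n) \<bullet> (u - v n) + t n) \<longlonglongrightarrow> grad f l \<bullet> (u - l) + 0"
      by (intro tendsto_intros tends(2)[OF f(1)] v(2) t)
    then have "\<forall>\<^sub>F n in sequentially. grad f (v n) \<bullet> (u - v n) + t n < 0"
      using f(2) by (auto dest: order_tendstoD(2))
    then show ?thesis by (rule eventually_mono) simp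
  qed
  have filtered: "\<forall>\<^sub>F n in sequentially. f (v n) \<ge> - s n \<longrightarrow> grad f (v n) \<bullet> (u - v n) \<le> - t n"
    if f: "\<exists>S. box_of P \<subseteq> S \<and> C2_on S f" "f l = 0 \<Longrightarrow> grad f l \<bullet> (u - l) < 0" "\<And>n. f (v n) \<le> 0"
      and s: "s \<longlonglongrightarrow> 0" and t: "t \<longlonglongrightarrow> 0" for f s t
  proof (cases "f l = 0")
    case True
    then show ?thesis using slope[OF f(1) f(2) t] by (auto elim: eventually_mono)
  next
    case False
    have "f l \<le> 0" using LIMSEQ_le_const2[OF tends(1)[OF f(1)]] f(3) by blast
    with False have "f l < 0" by simp
    moreover have "(\<lambda>n. f (v n) + s n) \<longlonglongrightarrow> f l + 0"
      by (intro tendsto_add tends(1)[OF f(1)] s)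
    ultimately have "\<forall>\<^sub>F n in sequentially. f (v n) + s n < 0"
      by (auto dest: order_tendstoD(2))
    then show ?thesis by (rule eventually_mono) simp
  qed
  have "\<forall>\<^sub>F n in sequentially. grad (cost P) (v n) \<bullet> (u - v n) \<le> - dphi n"
    by (rule slope[OF cost_C2 u(2) lims(5)])
  moreover have "\<forall>\<^sub>F n in sequentially. \<forall>j\<in>exp_idx P. exp_con P j (v n) \<ge> - (ep n $ j) \<longrightarrow>
      grad (exp_con P j) (v n) \<bullet> (u - v n) \<le> - (dp n $ j)"
  proof (rule eventually_ball_finite[OF finite], rule ballI)
    fix j assume j: "j \<in> exp_idx P"
    show "\<forall>\<^sub>F n in sequentially. exp_con P j (v n) \<ge> - (ep n $ j) \<longrightarrow>
        grad (exp_con P j) (v n) \<bullet> (u - v n) \<le> - (dp n $ j)"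
    proof (rule filtered)
      show "exp_con P j (v n) \<le> 0" for n
        using v(1)[of n] j by (auto simp: strictly_feasible_def less_imp_le)
    qed (use j exp_con_C2 u(3) tendsto_vec_nth[OF lims(1), of j] tendsto_vec_nth[OF lims(3), of j] in auto)
  qed
  moreover have "\<forall>\<^sub>F n in sequentially. \<forall>j\<in>num_idx P. num_con P j (v n) \<ge> - (e n $ j) \<longrightarrow>
      grad (num_con P j) (v n) \<bullet> (u - v n) \<le> - (d n $ j)"
  proof (rule eventually_ball_finite[OF finite], rule ballI)
    fix j assume j: "j \<in> num_idx P"
    show "\<forall>\<^sub>F n in sequentially. num_con P j (v n) \<ge> - (e n $ j) \<longrightarrow>
        grad (num_con P j) (v n) \<bullet> (u - v n) \<le> - (d n $ j)"
    proof (rule filtered)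
      show "num_con P j (v n) \<le> 0" for n
        using v(1)[of n] j by (auto simp: strictly_feasible_def)
    qed (use j num_con_C2 u(4) tendsto_vec_nth[OF lims(2), of j] tendsto_vec_nth[OF lims(4), of j] in auto)
  qed
  ultimately have "\<forall>\<^sub>F n in sequentially. u \<in> proj_set P (X n) (v n)"
    by eventually_elim (simp add: X_eq u(1))
  then show False using infeasible by simp
qed

lemma FJ_residual_tendsto:
  assumes v: "\<And>n. v n \<in> box_of P" "v \<longlonglongrightarrow> l" "l \<in> box_of P"
  shows "(\<lambda>n. FJ_residual P (v n) m) \<longlonglongrightarrow> FJ_residual P l m"
proof -
  obtain mphi mp mg zL zU where m: "m = (mphi, mp, mg, zL, zU)" by (cases m)
  note tends = C2_tendsto[OF _ v]
  show ?thesis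
    unfolding m FJ_residual.simps grad_lagrangian.simps
    using cost_C2 exp_con_C2 num_con_C2
    by (intro tendsto_intros tends v(2)) auto
qed

text \<open>The bound is uniform in the point, so that it applies to the stopping points of all runs at once.
  Points violating it for ever smaller parameters would accumulate at a stuck point, whose
  multipliers have small residuals at the points close to it.\<close>

lemma FJ_error_small_where_infeasible:
  assumes N: "is_norm N" and \<eta>: "0 < \<eta>"
  shows "\<exists>\<rho>>0. \<forall>prm\<in>positive_params. \<forall>v\<in>strictly_feasible P.
    dist prm 0 < \<rho> \<longrightarrow> proj_set P prm v = {} \<longrightarrow> FJ_error P N v < \<eta>"
proof (rule ccontr)
  assume neg: "\<not> ?thesis"
  have "\<forall>n. \<exists>prm v. prm \<in> positive_params \<and> v \<in> strictly_feasible P \<and>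
      dist prm 0 < inverse (real (Suc n)) \<and> proj_set P prm v = {} \<and> \<eta> \<le> FJ_error P N v"
  proof
    fix n
    have "0 < inverse (real (Suc n))" by simp
    with neg show "\<exists>prm v. prm \<in> positive_params \<and> v \<in> strictly_feasible P \<and>
      dist prm 0 < inverse (real (Suc n)) \<and> proj_set P prm v = {} \<and> \<eta> \<le> FJ_error P N v"
      by (meson not_less)
  qed
  then obtain X v where X: "\<And>n. X n \<in> positive_params" "\<And>n. dist (X n) 0 < inverse (real (Suc n))"
    and v: "\<And>n. v n \<in> strictly_feasible P" "\<And>n. proj_set P (X n) (v n) = {}"
      "\<And>n. \<eta> \<le> FJ_error P N (v n)"
    by metis
  have vbox: "v n \<in> box_of P" for n using v(1)[of n] by (simp add: strictly_feasible_def)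
  have "X \<longlonglongrightarrow> 0"
  proof (rule tendsto_dist_iff[THEN iffD2], rule tendsto_sandwich[of "\<lambda>_. 0" _ _ "\<lambda>n. inverse (real (Suc n))"])
    show "(\<lambda>n. inverse (real (Suc n))) \<longlonglongrightarrow> 0" by (rule LIMSEQ_inverse_real_of_nat)
    show "\<forall>\<^sub>F n in sequentially. dist (X n) 0 \<le> inverse (real (Suc n))"
      using X(2) by (intro always_eventually allI less_imp_le)
  qed auto
  obtain l r where l: "l \<in> box_of P" and r: "strict_mono r" "(v \<circ> r) \<longlonglongrightarrow> l"
    using compact_box_of vbox unfolding compact_def by metis
  have Xr: "(X \<circ> r) \<longlonglongrightarrow> 0" using LIMSEQ_subseq_LIMSEQ[OF \<open>X \<longlonglongrightarrow> 0\<close> r(1)] .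
  obtain m where m: "m \<in> unit_multipliers P N" "FJ_residual P l m = 0"
    using fritz_john_multipliers[OF N l infeasible_limit_is_stuck[of "X \<circ> r" "v \<circ> r" l]] X(1) Xr v(1,2) r(2)
    by auto
  have "(\<lambda>n. FJ_residual P ((v \<circ> r) n) m) \<longlonglongrightarrow> 0"
    using FJ_residual_tendsto[of "v \<circ> r" l m] vbox r(2) l m(2) by simp
  moreover have "\<eta> \<le> FJ_residual P ((v \<circ> r) n) m" for n
    using v(3)[of "r n"] FJ_error_attained[OF N, of P "v (r n)"] m(1) by force
  ultimately have "\<eta> \<le> 0" using LIMSEQ_le_const by blast
  with \<eta> show False by simp
qed

end

lemma FJ_residual_nonneg: "0 \<le> FJ_residual P u m"
  by (cases m) (auto intro!: add_nonneg_nonneg sum_nonneg)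

lemma FJ_error_nonneg: "is_norm N \<Longrightarrow> 0 \<le> FJ_error P N u"
  using FJ_error_attained FJ_residual_nonneg by metis

section \<open>Convergence of the scheme\<close>

theorem theorem5p10:
  fixes P :: "('n::finite, 'p::finite, 'g::finite) opt_problem"
    and \<kappa> :: "'p \<Rightarrow> 'n \<Rightarrow> real"
    and M :: "'n \<Rightarrow> 'n \<Rightarrow> real"
    and u0 :: "real ^ 'n"
    and N :: "('n, 'p, 'g) multipliers \<Rightarrow> real"
    and target u :: "('p, 'g) proj_params \<Rightarrow> nat \<Rightarrow> real ^ 'n"
  assumes cost_C2: "\<exists>S. box_of P \<subseteq> S \<and> C2_on S (cost P)"
    and exp_con_C2: "\<forall>j\<in>exp_idx P. \<exists>S. box_of P \<subseteq> S \<and> C2_on S (exp_con P j)"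
    and num_con_C2: "\<forall>j\<in>num_idx P. \<exists>S. box_of P \<subseteq> S \<and> C2_on S (num_con P j)"
    and u0_box: "u0 \<in> box_of P"
    and u0_exp: "\<forall>j\<in>exp_idx P. exp_con P j u0 < 0"
    and u0_num: "\<forall>j\<in>num_idx P. num_con P j u0 \<le> 0"
    and kappa: "\<forall>j\<in>exp_idx P. \<forall>i. \<forall>v\<in>box_of P.
      - \<kappa> j i < partial i (exp_con P j) v \<and> partial i (exp_con P j) v < \<kappa> j i"
    and M: "\<forall>i1 i2. \<forall>v\<in>box_of P.
      - M i1 i2 < partial i2 (partial i1 (cost P)) v \<and> partial i2 (partial i1 (cost P)) v < M i1 i2"
    and norm: "is_norm N"
    and run: "\<forall>prm\<in>positive_params. scheme_run P \<kappa> M u0 prm (target prm) (u prm)"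
  shows "(\<forall>prm\<in>positive_params. \<exists>k. proj_set P prm (u prm k) = {}) \<and>
    ((\<lambda>prm. FJ_error P N (u prm (first_infeasible P prm (u prm)))) \<longlongrightarrow> 0)
      (at 0 within positive_params)"
proof
  interpret filtered_scheme P \<kappa> M
    by unfold_locales (fact cost_C2 exp_con_C2 num_con_C2 kappa M)+
  have u0: "u0 \<in> strictly_feasible P"
    using u0_box u0_exp u0_num by (simp add: strictly_feasible_def)
  show stops: "\<forall>prm\<in>positive_params. \<exists>k. proj_set P prm (u prm k) = {}"
    using scheme_becomes_infeasible[OF _ u0] run by blast
  show "((\<lambda>prm. FJ_error P N (u prm (first_infeasible P prm (u prm)))) \<longlongrightarrow> 0)
      (at 0 within positive_params)"
  proof (rule tendstoI)
    fix \<eta> :: real assume "0 < \<eta>"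
    from FJ_error_small_where_infeasible[OF norm this]
    obtain \<rho> where \<rho>: "0 < \<rho>" "\<And>prm v. \<lbrakk>prm \<in> positive_params; v \<in> strictly_feasible P;
        dist prm 0 < \<rho>; proj_set P prm v = {}\<rbrakk> \<Longrightarrow> FJ_error P N v < \<eta>"
      by blast
    have "dist (FJ_error P N (u prm (first_infeasible P prm (u prm)))) 0 < \<eta>"
      if prm: "prm \<in> positive_params" "dist prm 0 < \<rho>" for prm
    proof -
      have "proj_set P prm (u prm (first_infeasible P prm (u prm))) = {}"
        unfolding first_infeasible_def by (rule LeastI_ex) (use stops prm(1) in blast)
      moreover have "u prm k \<in> strictly_feasible P" for k
        using run_strictly_feasible[OF u0] run prm(1) by blast
      ultimately show ?thesis
        using \<rho>(2)[OF prm(1) _ prm(2)] FJ_error_nonneg[OF norm] by (simp add: dist_norm)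
    qed
    with \<rho>(1) show "\<forall>\<^sub>F prm in at 0 within positive_params.
        dist (FJ_error P N (u prm (first_infeasible P prm (u prm)))) 0 < \<eta>"
      by (auto simp: eventually_at)
  qed
qed

end
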